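(* Let $k_1,k_2,k_3\in\mathbb{N}$, $\mathcal{F}=\mathbb{Q}(x,y,z)$, $\mathcal{L}=\mathbb{Q}[x^{\pm1},y^{\pm1},z^{\pm1}]$, $$\widehat{\mathcal{T}}=\frac{x^2+y^2+z^2+k_1yz+k_2xz+k_3xy}{xyz},$$ and let $\widehat{\Gamma}=\langle\widehat{\mu}_1,\widehat{\mu}_2,\widehat{\mu}_3\rangle$ be the generalized cluster mutation group with generators $$\widehat\mu_1(x,y,z)=\left(\tfrac{y^2+k_1yz+z^2}{x},y,z\right),\ \widehat\mu_2(x,y,z)=\left(x,\tfrac{x^2+k_2xz+z^2}{y},z\right),\ \widehat\mu_3(x,y,z)=\left(x,y,\tfrac{x^2+k_3xy+y^2}{z}\right).$$ Then, with $\mathcal{F}^{\widehat\Gamma}=\{f\in\mathcal{F}\mid f(\widehat\mu_i(x,y,z))=f,\ i=1,2,3\}$, $$\mathcal{F}^{\widehat\Gamma}=\mathbb{Q}(\widehat{\mathcal{T}}),\qquad \mathcal{F}^{\widehat\Gamma}\cap\mathcal{L}=\mathbb{Q}[\widehat{\mathcal{T}}].$$ In particular, for each $i\in\{1,2,3\}$, and up to a permutation of the variables, every Laurent mutation invariant of the classical cluster algebra with exchange matrix $B_i$ is a polynomial in $\mathcal{T}_i$; that is, $\mathcal{F}^{\Gamma_{B_i}}\cap\mathcal{L}=\mathbb{Q}[\mathcal{T}_i]$, with $B_i,\Gamma_{B_i},\mathcal{T}_i$ as defined in the context.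
   Context: $\mathbb{N}$ denotes the non-negative integers. Set $$B_1=\begin{pmatrix}0&2&-2\\-2&0&2\\2&-2&0\end{pmatrix},\quad B_2=\begin{pmatrix}0&1&-1\\-4&0&2\\4&-2&0\end{pmatrix},\quad B_3=\begin{pmatrix}0&4&-4\\-1&0&2\\1&-2&0\end{pmatrix},$$ $$\mathcal{T}_1=\frac{x^2+y^2+z^2}{xyz},\quad \mathcal{T}_2=\frac{x^2+y^4+z^4+2xy^2+2xz^2}{xy^2z^2},\quad \mathcal{T}_3=\frac{x^4+y^2+z^2+2yz}{x^2yz}.$$ $\Gamma_{B_i}=\langle\mu_1,\mu_2,\mu_3\rangle$ is the classical cluster mutation group, whose generators are (they do not change when $B_i$ is replaced by $-B_i$, and the mutation class of $B_i$ is $\{B_i,-B_i\}$): - $B_1$: $\mu_1(x,y,z)=(\frac{y^2+z^2}{x},y,z)$, $\mu_2(x,y,z)=(x,\frac{x^2+z^2}{y},z)$, $\mu_3(x,y,z)=(x,y,\frac{x^2+y^2}{z})$; - $B_2$: $\mu_1(x,y,z)=(\frac{y^4+z^4}{x},y,z)$, $\mu_2(x,y,z)=(x,\frac{x+z^2}{y},z)$, $\mu_3(x,y,z)=(x,y,\frac{x+y^2}{z})$; - $B_3$: $\mu_1(x,y,z)=(\frac{y+z}{x},y,z)$, $\mu_2(x,y,z)=(x,\frac{x^4+z^2}{y},z)$, $\mu_3(x,y,z)=(x,y,\frac{x^4+y^2}{z})$. $\mathcal{F}^{\Gamma_{B_i}}=\{f\in\mathcal{F}\mid f(\mu_j(x,y,z))=f,\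 j=1,2,3\}$. A Laurent mutation invariant is a non-constant element of $\mathcal{F}^{\Gamma_{B_i}}\cap\mathcal{L}$. "Up to a permutation of the variables" means that the assertion is also made for each matrix $\sigma(B_i)$, $\sigma\in\mathfrak{S}_3$, with entries $\sigma(B)_{ab}=b_{\sigma^{-1}(a)\sigma^{-1}(b)}$, with $\mathcal{T}_i(x_1,x_2,x_3)$ replaced by $\mathcal{T}_i(x_{\sigma(1)},x_{\sigma(2)},x_{\sigma(3)})$ (where $(x_1,x_2,x_3)=(x,y,z)$) and the mutations relabelled accordingly. *)

theory Defs
  imports
    "HOL-Analysis.Cartesian_Space"
    "HOL-Computational_Algebra.Field_as_Ring"
    "HOL-Computational_Algebra.Polynomial_Factorial"
    "HOL-Combinatorics.Permutations"
begin

section \<open>The field of rational functions in three variables\<close>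

text \<open>
  \<open>\<rat>[x,y,z]\<close> is the iterated polynomial ring \<open>\<rat>[x][y][z]\<close>: the innermost polynomial variable
  is \<open>x\<close>, the outermost one is \<open>z\<close>. Variables are indexed by the three-element type \<open>3\<close>,
  whose elements are \<open>1\<close>, \<open>2\<close> and \<open>3\<close> (the last one being the same as \<open>0\<close>).
\<close>

type_synonym poly3 = "rat poly poly poly"
type_synonym ratfun = "poly3 fract"

definition const :: "rat \<Rightarrow> ratfun" where
  "const c = to_fract [:[:[:c:]:]:]"

definition X :: "3 \<Rightarrow> ratfun" where
  "X i = (if i = 1 then to_fract [:[:[:0, 1:]:]:]
          else if i = 2 then to_fract [:[:0, 1:]:]
          else to_fract [:0, 1:])"

definition eval_poly3 :: "(3 \<Rightarrow> ratfun) \<Rightarrow> poly3 \<Rightarrow> ratfun" where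
  "eval_poly3 v P =
     poly (map_poly (\<lambda>Q. poly (map_poly (\<lambda>R. poly (map_poly const R) (v 1)) Q) (v 2)) P) (v 3)"

text \<open>
  \<open>subst v f\<close> is \<open>f (v 1, v 2, v 3)\<close>. It is computed from the coprime numerator and denominator
  of \<open>f\<close>; any other representation whose denominator does not vanish at \<open>v\<close> gives the same
  value, see \<open>subst_Fract\<close> below.
\<close>

definition subst :: "(3 \<Rightarrow> ratfun) \<Rightarrow> ratfun \<Rightarrow> ratfun" where
  "subst v f = eval_poly3 v (fst (quot_of_fract f)) / eval_poly3 v (snd (quot_of_fract f))"

definition laurent_ring :: "ratfun set" where
  "laurent_ring = {to_fract P / (X 1 ^ a * X 2 ^ b * X 3 ^ c) | P a b c. True}"

definition adjoin_ring :: "ratfun \<Rightarrow> ratfun set" where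
  "adjoin_ring t = {poly (map_poly const p) t | p. True}"

definition adjoin_field :: "ratfun \<Rightarrow> ratfun set" where
  "adjoin_field t = {poly (map_poly const p) t / poly (map_poly const q) t | p q.
             poly (map_poly const q) t \<noteq> 0}"


section \<open>Mutations and their invariants\<close>

text \<open>A family \<open>m\<close> of mutations sends \<open>k\<close> to the triple \<open>\<mu>\<^sub>k(x,y,z)\<close>.\<close>

definition invariant_field :: "(3 \<Rightarrow> 3 \<Rightarrow> ratfun) \<Rightarrow> ratfun set" where
  "invariant_field m = {f. \<forall>k. subst (m k) f = f}"

text \<open>
  The exchange relation is read off the columns of the exchange matrix. Since \<^const>\<open>nat\<close> truncates
  negative integers to \<open>0\<close>, the two products are those over the positive and over the negative
  entries of the \<open>k\<close>-th column.
\<close>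

definition cluster_mutation :: "int^3^3 \<Rightarrow> 3 \<Rightarrow> 3 \<Rightarrow> ratfun" where
  "cluster_mutation B k =
     X(k := ((\<Prod>i\<in>UNIV. X i ^ nat (B $ i $ k)) + (\<Prod>i\<in>UNIV. X i ^ nat (- (B $ i $ k)))) / X k)"

definition gen_mutation :: "nat \<Rightarrow> nat \<Rightarrow> nat \<Rightarrow> 3 \<Rightarrow> 3 \<Rightarrow> ratfun" where
  "gen_mutation k1 k2 k3 k =
     (if k = 1 then X(1 := (X 2 ^ 2 + of_nat k1 * X 2 * X 3 + X 3 ^ 2) / X 1)
      else if k = 2 then X(2 := (X 1 ^ 2 + of_nat k2 * X 1 * X 3 + X 3 ^ 2) / X 2)
      else X(3 := (X 1 ^ 2 + of_nat k3 * X 1 * X 2 + X 2 ^ 2) / X 3))"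

definition T_hat :: "nat \<Rightarrow> nat \<Rightarrow> nat \<Rightarrow> ratfun" where
  "T_hat k1 k2 k3 =
     (X 1 ^ 2 + X 2 ^ 2 + X 3 ^ 2
        + of_nat k1 * X 2 * X 3 + of_nat k2 * X 1 * X 3 + of_nat k3 * X 1 * X 2)
     / (X 1 * X 2 * X 3)"

definition B1 :: "int^3^3" where
  "B1 = vector [vector [0, 2, -2], vector [-2, 0, 2], vector [2, -2, 0]]"

definition B2 :: "int^3^3" where
  "B2 = vector [vector [0, 1, -1], vector [-4, 0, 2], vector [4, -2, 0]]"

definition B3 :: "int^3^3" where
  "B3 = vector [vector [0, 4, -4], vector [-1, 0, 2], vector [1, -2, 0]]"

definition T1 :: "(3 \<Rightarrow> ratfun) \<Rightarrow> ratfun" where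
  "T1 v = (v 1 ^ 2 + v 2 ^ 2 + v 3 ^ 2) / (v 1 * v 2 * v 3)"

definition T2 :: "(3 \<Rightarrow> ratfun) \<Rightarrow> ratfun" where
  "T2 v = (v 1 ^ 2 + v 2 ^ 4 + v 3 ^ 4 + 2 * v 1 * v 2 ^ 2 + 2 * v 1 * v 3 ^ 2)
          / (v 1 * v 2 ^ 2 * v 3 ^ 2)"

definition T3 :: "(3 \<Rightarrow> ratfun) \<Rightarrow> ratfun" where
  "T3 v = (v 1 ^ 4 + v 2 ^ 2 + v 3 ^ 2 + 2 * v 2 * v 3) / (v 1 ^ 2 * v 2 * v 3)"

definition permute_matrix :: "(3 \<Rightarrow> 3) \<Rightarrow> int^3^3 \<Rightarrow> int^3^3" where
  "permute_matrix \<sigma> B = (\<chi> a b. B $ inv \<sigma> a $ inv \<sigma> b)"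


section \<open>Basic facts\<close>

lemma const_0 [simp]: "const 0 = 0"
  and const_1 [simp]: "const 1 = 1"
  and const_add: "const (a + b) = const a + const b"
  and const_mult: "const (a * b) = const a * const b"
  by (simp_all only: const_def pCons_0_0 to_fract_0 one_pCons[symmetric] to_fract_1
        to_fract_add[symmetric] to_fract_mult[symmetric]) simp_all

lemma map_poly_add_hom:
  assumes "h 0 = 0" "\<And>a b. h (a + b) = h a + h b"
  shows "map_poly h (p + q) = map_poly h p + map_poly h q"
  by (rule poly_eqI) (simp add: coeff_map_poly assms)

lemma map_poly_mult_hom:
  fixes h :: "'a :: comm_semiring_0 \<Rightarrow> 'b :: comm_semiring_0"
  assumes "h 0 = 0" "\<And>a b. h (a + b) = h a + h b" "\<And>a b. h (a * b) = h a * h b"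
  shows "map_poly h (p * q) = map_poly h p * map_poly h q"
proof (rule poly_eqI)
  fix n
  have s: "h (sum g A) = (\<Sum>i\<in>A. h (g i))" if "finite A" for g :: "nat \<Rightarrow> 'a" and A
    using that by (induction A rule: finite_induct) (simp_all add: assms)
  show "coeff (map_poly h (p * q)) n = coeff (map_poly h p * map_poly h q) n"
    by (simp add: coeff_map_poly coeff_mult assms s)
qed

lemma eval_poly3_mult: "eval_poly3 v (P * Q) = eval_poly3 v P * eval_poly3 v Q"
proof -
  define h1 where "h1 = (\<lambda>R. poly (map_poly const R) (v 1))"
  have h1: "h1 0 = 0" "h1 (a + b) = h1 a + h1 b" "h1 (a * b) = h1 a * h1 b" for a b
    by (simp_all add: h1_def map_poly_add_hom const_add map_poly_mult_hom const_mult)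
  define h2 where "h2 = (\<lambda>R. poly (map_poly h1 R) (v 2))"
  have h2: "h2 0 = 0" "h2 (a + b) = h2 a + h2 b" "h2 (a * b) = h2 a * h2 b" for a b
    by (simp_all add: h2_def map_poly_add_hom h1 map_poly_mult_hom)
  show ?thesis
    unfolding eval_poly3_def h1_def[symmetric] h2_def[symmetric]
    by (simp add: map_poly_mult_hom h2)
qed

lemma subst_Fract:
  assumes "eval_poly3 v Q \<noteq> 0"
  shows "subst v (Fract P Q) = eval_poly3 v P / eval_poly3 v Q"
proof -
  have "Q \<noteq> 0"
    using assms by (auto simp: eval_poly3_def)
  obtain p q where pq: "quot_of_fract (Fract P Q) = (p, q)"
    by (cases "quot_of_fract (Fract P Q)")
  have "Fract p q = Fract P Q" "q \<noteq> 0"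
    using quot_to_fract_quot_of_fract[of "Fract P Q"] snd_quot_of_fract_nonzero[of "Fract P Q"]
    by (simp_all add: pq quot_to_fract_def)
  then have eq: "p * Q = P * q"
    using \<open>Q \<noteq> 0\<close> by (simp add: eq_fract)
  have "coprime p q"
    using coprime_quot_of_fract[of "Fract P Q"] by (simp add: pq)
  moreover have "q dvd p * Q"
    by (simp add: eq)
  ultimately have "q dvd Q"
    by (simp add: coprime_commute coprime_dvd_mult_right_iff)
  then obtain d where "Q = q * d" ..
  then have "eval_poly3 v q \<noteq> 0"
    using assms by (auto simp: eval_poly3_mult)
  moreover have "eval_poly3 v p * eval_poly3 v Q = eval_poly3 v P * eval_poly3 v q"
    using eq by (simp flip: eval_poly3_mult)
  ultimately show ?thesis
    using assms by (simp add: subst_def pq frac_eq_eq)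
qed

lemma nat_minus_one: "nat (- 1) = 0"
  by simp

lemmas mutation_simps = nat_numeral nat_0 nat_1 One_nat_def[symmetric] nat_neg_numeral nat_minus_one
  minus_minus minus_zero power_0 power_one_right mult_1_left mult_1_right

lemma cluster_mutation_expand:
  "cluster_mutation B k = X(k :=
     (X 1 ^ nat (B $ 1 $ k) * (X 2 ^ nat (B $ 2 $ k) * X 3 ^ nat (B $ 3 $ k))
      + X 1 ^ nat (- (B $ 1 $ k)) * (X 2 ^ nat (- (B $ 2 $ k)) * X 3 ^ nat (- (B $ 3 $ k)))) / X k)"
  by (simp only: cluster_mutation_def UNIV_3 prod.insert prod.empty finite.intros) simp

lemma cluster_mutation_B1:
  "cluster_mutation B1 1 = X(1 := (X 2 ^ 2 + X 3 ^ 2) / X 1)"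
  "cluster_mutation B1 2 = X(2 := (X 1 ^ 2 + X 3 ^ 2) / X 2)"
  "cluster_mutation B1 3 = X(3 := (X 1 ^ 2 + X 2 ^ 2) / X 3)"
  by (simp_all only: cluster_mutation_expand B1_def vector_3 mutation_simps add.commute)

lemma cluster_mutation_B2:
  "cluster_mutation B2 1 = X(1 := (X 2 ^ 4 + X 3 ^ 4) / X 1)"
  "cluster_mutation B2 2 = X(2 := (X 1 + X 3 ^ 2) / X 2)"
  "cluster_mutation B2 3 = X(3 := (X 1 + X 2 ^ 2) / X 3)"
  by (simp_all only: cluster_mutation_expand B2_def vector_3 mutation_simps add.commute)

lemma cluster_mutation_B3:
  "cluster_mutation B3 1 = X(1 := (X 2 + X 3) / X 1)"
  "cluster_mutation B3 2 = X(2 := (X 1 ^ 4 + X 3 ^ 2) / X 2)"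
  "cluster_mutation B3 3 = X(3 := (X 1 ^ 4 + X 2 ^ 2) / X 3)"
  by (simp_all only: cluster_mutation_expand B3_def vector_3 mutation_simps add.commute)

end

theory Submission
  imports Defs "HOL-Computational_Algebra.Fundamental_Theorem_Algebra"
begin

text \<open>
  The involution \<open>\<mu>\<^sub>i\<close> generates the Galois group of \<open>\<rat>(x,y,z)\<close> over \<open>\<rat>(T, X\<^sub>j, X\<^sub>k)\<close>, because
  \<open>X\<^sub>i + A\<^sub>i / X\<^sub>i\<close> is a rational expression in \<open>T, X\<^sub>j, X\<^sub>k\<close>; so an invariant \<open>f\<close> lies in that field.
  The group generated by \<open>\<mu>\<^sub>i\<close> and \<open>\<mu>\<^sub>j\<close> fixes \<open>f\<close>, \<open>T\<close> and \<open>X\<^sub>k\<close>, but moves \<open>X\<^sub>j\<close> through an infinite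
  orbit, since its values at \<open>(1,1,1)\<close> strictly increase. Writing \<open>f = p(X\<^sub>j) / q(X\<^sub>j)\<close> over
  \<open>\<rat>(T, X\<^sub>k)\<close>, all of the orbit are roots of \<open>p - f q\<close>, which therefore vanishes, and \<open>f\<close> lies in
  \<open>\<rat>(T, X\<^sub>k)\<close>. The same argument for \<open>\<mu>\<^sub>i\<close> and \<open>\<mu>\<^sub>k\<close> gives \<open>f \<in> \<rat>(T)\<close>. If \<open>f\<close> is also a Laurent
  polynomial, then it has no pole on the complex torus, where \<open>T\<close> takes every complex value, so \<open>f\<close> is
  a polynomial in \<open>T\<close>.
\<close>


section \<open>Values of rational functions\<close>

text \<open>Makes \<open>of_rat\<close> available on \<open>ratfun\<close>, so that rational
  coefficients embed in the same way into rational functions, real and complex numbers.\<close>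

instance fract :: ("{idom, ring_char_0}") field_char_0
proof
  show "inj (of_nat :: nat \<Rightarrow> 'a fract)"
    by (rule injI) (simp add: of_nat_fract eq_fract)
qed

text \<open>A unital map on the rationals that respects sums and products is determined on the
  integers, hence on quotients of integers.\<close>

lemma const_eq_of_rat: "const c = of_rat c"
proof (induction c)
  case (Fract a b)
  have nat: "const (of_nat n) = of_nat n" for n
    by (induction n) (simp_all add: const_add)
  have neg: "const (- c) = - const c" for c
    using const_add[of c "- c"] by (simp add: minus_unique)
  have int: "const (of_int n) = of_int n" for n
    by (cases n rule: int_cases2) (simp_all add: nat neg)
  have "const (Rat.Fract a b) * of_int b = of_int a"
    using Fract by (simp add: Fract_of_int_quotient flip: int const_mult)
  then show ?case
    using Fract by (simp add: Fract_of_int_quotient of_rat_divide field_simps)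
qed

text \<open>The target field is left open: rational functions give substitution, real numbers the
  growth estimates, complex numbers the points of the torus.\<close>

definition eval3 :: "(3 \<Rightarrow> 'b::field_char_0) \<Rightarrow> poly3 \<Rightarrow> 'b" where
  "eval3 v P =
     poly (map_poly (\<lambda>Q. poly (map_poly (\<lambda>R. poly (map_poly of_rat R) (v 1)) Q) (v 2)) P) (v 3)"

lemma eval_poly3_eq: "eval_poly3 = eval3"
  by (intro ext) (simp add: eval_poly3_def eval3_def const_eq_of_rat[abs_def])

lemma eval3_add: "eval3 v (P + Q) = eval3 v P + eval3 v Q"
  and eval3_mult: "eval3 v (P * Q) = eval3 v P * eval3 v Q"
proof -
  define h1 where "h1 = (\<lambda>R. poly (map_poly of_rat R) (v 1))"
  have h1: "h1 0 = 0" "h1 (a + b) = h1 a + h1 b" "h1 (a * b) = h1 a * h1 b" for a b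
    by (simp_all add: h1_def map_poly_add_hom of_rat_add map_poly_mult_hom of_rat_mult)
  define h2 where "h2 = (\<lambda>R. poly (map_poly h1 R) (v 2))"
  have h2: "h2 0 = 0" "h2 (a + b) = h2 a + h2 b" "h2 (a * b) = h2 a * h2 b" for a b
    by (simp_all add: h2_def map_poly_add_hom h1 map_poly_mult_hom)
  show "eval3 v (P + Q) = eval3 v P + eval3 v Q" "eval3 v (P * Q) = eval3 v P * eval3 v Q"
    unfolding eval3_def h1_def[symmetric] h2_def[symmetric]
    by (simp_all add: map_poly_add_hom map_poly_mult_hom h2)
qed

lemma eval3_const [simp]: "eval3 v [:[:[:c:]:]:] = of_rat c"
  and eval3_X1 [simp]: "eval3 v [:[:[:0, 1:]:]:] = v 1"
  and eval3_X2 [simp]: "eval3 v [:[:0, 1:]:] = v 2"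
  and eval3_X3 [simp]: "eval3 v [:0, 1:] = v 3"
  by (simp_all add: eval3_def map_poly_pCons)

lemma eval3_0 [simp]: "eval3 v 0 = 0"
  by (simp add: eval3_def)

lemma eval3_1 [simp]: "eval3 v 1 = 1"
  using eval3_const[of v 1] by (simp add: one_pCons)

text \<open>Constants and variables generate the iterated polynomial ring; each of the three layers
  is unfolded by \<open>pCons a p = [:a:] + [:0, 1:] * p\<close>.\<close>

lemma poly3_induct [case_names const X1 X2 X3 add mult]:
  assumes "\<And>c. R [:[:[:c:]:]:]" "R [:[:[:0, 1:]:]:]" "R [:[:0, 1:]:]" "R [:0, 1:]"
    and add: "\<And>P Q. R P \<Longrightarrow> R Q \<Longrightarrow> R (P + Q)"
    and mult: "\<And>P Q. R P \<Longrightarrow> R Q \<Longrightarrow> R (P * Q)"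
  shows "R (P :: poly3)"
proof -
  have 0: "R 0"
    using assms(1)[of 0] by simp
  have 1: "R [:[:p:]:]" for p
  proof (induction p)
    case (pCons a p)
    have "[:[:pCons a p:]:] = [:[:[:a:]:]:] + [:[:[:0, 1:]:]:] * [:[:p:]:]"
      by simp
    then show ?case
      using pCons assms by metis
  qed (simp add: 0)
  have 2: "R [:p:]" for p
  proof (induction p)
    case (pCons a p)
    have "[:pCons a p:] = [:[:a:]:] + [:[:0, 1:]:] * [:p:]"
      by simp
    then show ?case
      using pCons 1 assms by metis
  qed (simp add: 0)
  show ?thesis
  proof (induction P)
    case (pCons a p)
    have "pCons a p = [:a:] + [:0, 1:] * p"
      by simp
    then show ?case
      using pCons 2 assms by metis
  qed (simp add: 0)
qed

definition has_value :: "(3 \<Rightarrow> 'b::field_char_0) \<Rightarrow> ratfun \<Rightarrow> 'b \<Rightarrow> bool" where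
  "has_value v f c \<longleftrightarrow> (\<exists>P Q. f = Fract P Q \<and> eval3 v Q \<noteq> 0 \<and> c = eval3 v P / eval3 v Q)"

lemma has_valueI:
  "f = Fract P Q \<Longrightarrow> eval3 v Q \<noteq> 0 \<Longrightarrow> c = eval3 v P / eval3 v Q \<Longrightarrow> has_value v f c"
  unfolding has_value_def by blast

text \<open>Evaluation preserves the cross-multiplied equation of two representations of
  \<open>f\<close>.\<close>

lemma has_value_unique:
  assumes "has_value v f c" "has_value v f d"
  shows "c = d"
proof -
  obtain P Q P' Q' where *: "f = Fract P Q" "eval3 v Q \<noteq> 0" "c = eval3 v P / eval3 v Q"
      "f = Fract P' Q'" "eval3 v Q' \<noteq> 0" "d = eval3 v P' / eval3 v Q'"
    using assms unfolding has_value_def by blast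
  have "Q \<noteq> 0" "Q' \<noteq> 0"
    using * by auto
  then have "P * Q' = P' * Q"
    using * by (simp add: eq_fract)
  then have "eval3 v P * eval3 v Q' = eval3 v P' * eval3 v Q"
    by (simp flip: eval3_mult)
  then show ?thesis
    using * by (simp add: frac_eq_eq)
qed

lemma subst_has_value:
  assumes "has_value v f c"
  shows "subst v f = c"
  using assms by (auto simp: has_value_def subst_Fract eval_poly3_eq)

lemma has_value_to_fract: "has_value v (to_fract P) (eval3 v P)"
  by (rule has_valueI[of _ P 1]) (simp_all add: to_fract_def)

lemma has_value_X: "has_value v (X i) (v i)"
  using has_value_to_fract[of v "[:[:[:0, 1:]:]:]"] has_value_to_fract[of v "[:[:0, 1:]:]"]
    has_value_to_fract[of v "[:0, 1:]"] exhaust_3[of i]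
  by (auto simp: X_def)

lemma has_value_of_rat: "has_value v (of_rat c) (of_rat c)"
  using has_value_to_fract[of v "[:[:[:c:]:]:]"] by (simp add: const_def flip: const_eq_of_rat)

lemma has_value_0: "has_value v 0 0" and has_value_1: "has_value v 1 1"
  using has_value_of_rat[of v 0] has_value_of_rat[of v 1] by simp_all

lemma has_value_of_nat: "has_value v (of_nat n) (of_nat n)"
  using has_value_of_rat[of v "of_nat n"] by simp

lemma has_value_numeral: "has_value v (numeral n) (numeral n)"
  using has_value_of_rat[of v "numeral n"] by simp

lemma has_value_mult:
  assumes "has_value v f c" "has_value v g d"
  shows "has_value v (f * g) (c * d)"
proof -
  obtain P Q P' Q' where *: "f = Fract P Q" "eval3 v Q \<noteq> 0" "c = eval3 v P / eval3 v Q"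
      "g = Fract P' Q'" "eval3 v Q' \<noteq> 0" "d = eval3 v P' / eval3 v Q'"
    using assms unfolding has_value_def by blast
  then show ?thesis
    by (intro has_valueI[of _ "P * P'" "Q * Q'"]) (simp_all add: eval3_mult)
qed

lemma has_value_add:
  assumes "has_value v f c" "has_value v g d"
  shows "has_value v (f + g) (c + d)"
proof -
  obtain P Q P' Q' where *: "f = Fract P Q" "eval3 v Q \<noteq> 0" "c = eval3 v P / eval3 v Q"
      "g = Fract P' Q'" "eval3 v Q' \<noteq> 0" "d = eval3 v P' / eval3 v Q'"
    using assms unfolding has_value_def by blast
  moreover have "Q \<noteq> 0" "Q' \<noteq> 0"
    using * by auto
  ultimately show ?thesis
    by (intro has_valueI[of _ "P * Q' + P' * Q" "Q * Q'"])
       (simp_all add: eval3_mult eval3_add add_frac_eq)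
qed

lemma has_value_divide:
  assumes "has_value v f c" "has_value v g d" "d \<noteq> 0"
  shows "has_value v (f / g) (c / d)"
proof -
  obtain P Q P' Q' where *: "f = Fract P Q" "eval3 v Q \<noteq> 0" "c = eval3 v P / eval3 v Q"
      "g = Fract P' Q'" "eval3 v Q' \<noteq> 0" "d = eval3 v P' / eval3 v Q'"
    using assms unfolding has_value_def by blast
  then show ?thesis
    using \<open>d \<noteq> 0\<close> by (intro has_valueI[of _ "P * Q'" "Q * P'"]) (simp_all add: eval3_mult)
qed

lemma has_value_power: "has_value v f c \<Longrightarrow> has_value v (f ^ n) (c ^ n)"
  by (induction n) (auto intro: has_value_1 has_value_mult)

lemmas has_value_intros = has_value_0 has_value_1 has_value_X has_value_of_nat has_value_numeral
  has_value_add has_value_mult has_value_power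

lemma has_value_poly:
  assumes "has_value v f c"
  shows "has_value v (poly (map_poly of_rat p) f) (poly (map_poly of_rat p) c)"
  by (induction p)
     (auto simp: map_poly_pCons intro!: has_value_intros has_value_of_rat assms)

lemma X_nonzero [simp]: "X i \<noteq> 0"
  using has_value_X[of "\<lambda>_. 1 :: rat" i] has_value_0[of "\<lambda>_. 1 :: rat"] has_value_unique by fastforce


section \<open>Subfields and field homomorphisms\<close>

text \<open>The subfield generated by \<open>S\<close>. Differences and quotients suffice, which
  keeps inductions short; division by 0 only contributes 0.\<close>

inductive_set gen :: "ratfun set \<Rightarrow> ratfun set" for S where
  gen_base: "f \<in> S \<Longrightarrow> f \<in> gen S"
| gen_1: "1 \<in> gen S"
| gen_diff: "f \<in> gen S \<Longrightarrow> g \<in> gen S \<Longrightarrow> f - g \<in> gen S"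
| gen_divide: "f \<in> gen S \<Longrightarrow> g \<in> gen S \<Longrightarrow> f / g \<in> gen S"

lemma gen_0: "0 \<in> gen S"
  using gen_diff[OF gen_1 gen_1] by simp

lemma gen_uminus: "f \<in> gen S \<Longrightarrow> - f \<in> gen S"
  using gen_diff[OF gen_0, of f] by simp

lemma gen_add: "f \<in> gen S \<Longrightarrow> g \<in> gen S \<Longrightarrow> f + g \<in> gen S"
  using gen_diff[OF _ gen_uminus, of f S g] by simp

lemma gen_inverse: "f \<in> gen S \<Longrightarrow> inverse f \<in> gen S"
  using gen_divide[OF gen_1, of f] by (simp add: field_simps)

lemma gen_mult: "f \<in> gen S \<Longrightarrow> g \<in> gen S \<Longrightarrow> f * g \<in> gen S"
  using gen_divide[OF _ gen_inverse, of f S g] by (simp add: field_simps)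

lemma gen_power: "f \<in> gen S \<Longrightarrow> f ^ n \<in> gen S"
  by (induction n) (auto intro: gen_1 gen_mult)

lemma gen_of_nat: "of_nat n \<in> gen S"
  by (induction n) (auto intro: gen_0 gen_1 gen_add)

lemma gen_numeral: "numeral n \<in> gen S"
  using gen_of_nat[of "numeral n"] by simp

lemma gen_of_rat: "of_rat c \<in> gen S"
proof (induction c)
  case (Fract a b)
  have "of_int n \<in> gen S" for n
    by (cases n rule: int_cases2) (auto intro: gen_uminus gen_of_nat)
  then show ?case
    using Fract by (simp add: Fract_of_int_quotient of_rat_divide gen_divide)
qed

lemma gen_sum: "(\<And>x. x \<in> A \<Longrightarrow> h x \<in> gen S) \<Longrightarrow> sum h A \<in> gen S"
  by (induction A rule: infinite_finite_induct) (auto intro: gen_0 gen_add)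

lemmas gen_intros = gen_0 gen_1 gen_add gen_diff gen_mult gen_divide gen_power gen_of_nat gen_numeral

lemma gen_trans: "f \<in> gen S \<Longrightarrow> S \<subseteq> gen S' \<Longrightarrow> f \<in> gen S'"
  by (induction rule: gen.induct) (auto intro: gen_intros)

lemma gen_range_X: "f \<in> gen (range X)"
proof -
  have "to_fract P \<in> gen (range X)" for P
  proof (induction P rule: poly3_induct)
    case (const c)
    then show ?case
      using gen_of_rat[of c] by (simp add: const_def flip: const_eq_of_rat)
  next
    case X1
    have "X 1 \<in> gen (range X)"
      by (rule gen_base) simp
    then show ?case by (simp add: X_def)
  next
    case X2
    have "X 2 \<in> gen (range X)"
      by (rule gen_base) simp
    then show ?case by (simp add: X_def)
  next
    case X3
    have "X 3 \<in> gen (range X)"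
      by (rule gen_base) simp
    then show ?case by (simp add: X_def)
  qed (auto intro: gen_intros)
  moreover obtain P Q where "f = to_fract P / to_fract Q"
    by (cases f) (auto simp: to_fract_def)
  ultimately show ?thesis
    by (simp add: gen_divide)
qed

section \<open>Homomorphisms of the field of rational functions\<close>

locale field_hom =
  fixes \<phi> :: "ratfun \<Rightarrow> ratfun"
  assumes hom_1 [simp]: "\<phi> 1 = 1"
    and hom_add [simp]: "\<phi> (f + g) = \<phi> f + \<phi> g"
    and hom_mult [simp]: "\<phi> (f * g) = \<phi> f * \<phi> g"
begin

lemma hom_0 [simp]: "\<phi> 0 = 0"
  using hom_add[of 0 0] by (simp del: hom_add)

lemma hom_uminus [simp]: "\<phi> (- f) = - \<phi> f"
  using hom_add[of f "- f"] by (simp add: minus_unique del: hom_add)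

lemma hom_diff [simp]: "\<phi> (f - g) = \<phi> f - \<phi> g"
  using hom_add[of f "- g"] by (simp del: hom_add)

lemma hom_eq_0_iff [simp]: "\<phi> f = 0 \<longleftrightarrow> f = 0"
  using hom_mult[of f "inverse f"] by (cases "f = 0") (auto simp del: hom_mult)

lemma hom_divide [simp]: "\<phi> (f / g) = \<phi> f / \<phi> g"
  using hom_mult[of "f / g" g] by (cases "g = 0") (auto simp: field_simps simp del: hom_mult)

lemma hom_power [simp]: "\<phi> (f ^ n) = \<phi> f ^ n"
  by (induction n) auto

lemma hom_of_nat [simp]: "\<phi> (of_nat n) = of_nat n"
  by (induction n) auto

lemma hom_gen_id:
  assumes "f \<in> gen S" "\<And>g. g \<in> S \<Longrightarrow> \<phi> g = g"
  shows "\<phi> f = f"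
  using assms(1) by (induction rule: gen.induct) (auto simp: assms(2))

lemma hom_poly_gen:
  assumes "\<And>n. coeff p n \<in> gen S" "\<And>g. g \<in> S \<Longrightarrow> \<phi> g = g"
  shows "\<phi> (poly p x) = poly p (\<phi> x)"
proof -
  have "\<phi> (coeff p n) = coeff p n" for n
    using hom_gen_id assms by blast
  then show ?thesis
  proof (induction p)
    case (pCons a p)
    have "\<phi> a = a" "\<phi> (coeff p n) = coeff p n" for n
      using pCons(3)[of 0] pCons(3)[of "Suc n"] by simp_all
    then show ?case
      using pCons.IH by simp
  qed simp
qed

end

lemma field_hom_comp: "field_hom \<phi> \<Longrightarrow> field_hom \<psi> \<Longrightarrow> field_hom (\<phi> \<circ> \<psi>)"
  by (simp add: field_hom_def)

lemma field_hom_funpow: "field_hom \<phi> \<Longrightarrow> field_hom (\<phi> ^^ n)"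
  by (induction n) (auto intro: field_hom_comp simp: field_hom_def)

text \<open>If \<open>m\<close> undoes itself, composition with \<open>m\<close> is injective on polynomials, so no denominator
  vanishes at \<open>m\<close>.\<close>

lemma field_hom_subst:
  assumes "\<And>i. has_value m (m i) (X i)"
  shows "field_hom (subst m)" and "subst m (X i) = m i"
proof -
  have mutate_twice: "has_value m (eval3 m P) (to_fract P)" for P
  proof (induction P rule: poly3_induct)
    case (const c)
    then show ?case
      using has_value_of_rat[of m c] by (simp add: const_def flip: const_eq_of_rat)
  next
    case X1
    then show ?case
      using assms[of 1] by (simp add: X_def)
  next
    case X2
    then show ?case
      using assms[of 2] by (simp add: X_def)
  next
    case X3
    then show ?case
      using assms[of 3] by (simp add: X_def)
  qed (auto simp: eval3_add eval3_mult intro: has_value_add has_value_mult)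
  have nz: "eval3 m P \<noteq> 0" if "P \<noteq> 0" for P
    using mutate_twice[of P] has_value_unique[OF has_value_0] that
    by (metis to_fract_0 to_fract_eq_iff)
  have value_subst: "has_value m f (subst m f)" for f
  proof (cases f)
    case (Fract P Q)
    then have "eval3 m Q \<noteq> 0"
      by (simp add: nz)
    then show ?thesis
      by (intro has_valueI[of _ P Q]) (simp_all add: Fract(1) subst_Fract eval_poly3_eq)
  qed
  note unique = has_value_unique[OF value_subst]
  show "field_hom (subst m)"
    by unfold_locales
      (intro unique has_value_1 has_value_add has_value_mult value_subst)+
  show "subst m (X i) = m i"
    by (intro unique has_value_X)
qed

text \<open>Quotients of polynomials in \<open>x\<close> over \<open>gen S\<close> contain the
  generators and are closed under differences and quotients.\<close>

lemma gen_insert_quotient: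
  assumes "f \<in> gen (insert x S)"
  shows "\<exists>p q. (\<forall>n. coeff p n \<in> gen S) \<and> (\<forall>n. coeff q n \<in> gen S) \<and> poly q x \<noteq> 0 \<and>
    f = poly p x / poly q x"
proof -
  define G where "G = {p. \<forall>n. coeff p n \<in> gen S}"
  have G_const: "[:g:] \<in> G" if "g \<in> gen S" for g
    using that by (auto simp: G_def coeff_pCons gen_0 split: nat.split)
  have G_diff: "p - q \<in> G" and G_mult: "p * q \<in> G" if "p \<in> G" "q \<in> G" for p q
    using that by (auto simp: G_def coeff_mult intro!: gen_sum gen_intros)
  have G_1: "1 \<in> G"
    using G_const[OF gen_1] by (simp add: one_pCons)
  have G_x: "[:0, 1:] \<in> G"
    by (auto simp: G_def coeff_pCons gen_0 gen_1 split: nat.split)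
  have "\<exists>p \<in> G. \<exists>q \<in> G. poly q x \<noteq> 0 \<and> f = poly p x / poly q x"
    using assms
  proof (induction rule: gen.induct)
    case (gen_base f)
    then consider "f = x" | "f \<in> gen S"
      by (auto intro: gen.gen_base)
    then show ?case
    proof cases
      case 1
      then show ?thesis
        using G_x G_1 by (intro bexI[of _ "[:0, 1:]"] bexI[of _ 1]) simp_all
    next
      case 2
      then show ?thesis
        using G_const[of f] G_1 by (intro bexI[of _ "[:f:]"] bexI[of _ 1]) simp_all
    qed
  next
    case gen_1
    then show ?case
      using G_1 by (intro bexI[of _ 1]) simp_all
  next
    case (gen_diff f g)
    then obtain p q p' q' where *: "p \<in> G" "q \<in> G" "poly q x \<noteq> 0" "f = poly p x / poly q x"
        "p' \<in> G" "q' \<in> G" "poly q' x \<noteq> 0" "g = poly p' x / poly q' x"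
      by metis
    show ?case
      using * by (intro bexI[of _ "p * q' - p' * q"] bexI[of _ "q * q'"])
        (simp_all add: G_diff G_mult diff_frac_eq)
  next
    case (gen_divide f g)
    then obtain p q p' q' where *: "p \<in> G" "q \<in> G" "poly q x \<noteq> 0" "f = poly p x / poly q x"
        "p' \<in> G" "q' \<in> G" "poly q' x \<noteq> 0" "g = poly p' x / poly q' x"
      by metis
    show ?case
    proof (cases "g = 0")
      \<comment> \<open>Here \<open>f / g\<close> is 0 by convention, represented as 0 over
        1.\<close>
      case True
      then show ?thesis
        using G_const[OF gen_0] G_1 by (intro bexI[of _ 0] bexI[of _ 1]) simp_all
    next
      case False
      then show ?thesis
        using * by (intro bexI[of _ "p * q'"] bexI[of _ "q * p'"]) (simp_all add: G_mult)
    qed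
  qed
  then show ?thesis
    by (auto simp: G_def)
qed

text \<open>If \<open>f = p x / q x\<close> with \<open>p\<close> and \<open>q\<close> over \<open>gen S\<close>, then every conjugate of \<open>x\<close> is a root of
  \<open>p - f q\<close>; having infinitely many roots, this polynomial vanishes.\<close>

lemma gen_descend:
  fixes \<phi> :: "nat \<Rightarrow> ratfun \<Rightarrow> ratfun"
  assumes f: "f \<in> gen (insert x S)"
    and hom: "\<And>n. field_hom (\<phi> n)"
    and S: "\<And>n g. g \<in> S \<Longrightarrow> \<phi> n g = g"
    and fixed: "\<And>n. \<phi> n f = f"
    and infinite: "infinite (range (\<lambda>n. \<phi> n x))"
  shows "f \<in> gen S"
proof -
  obtain p q where pq: "\<And>n. coeff p n \<in> gen S" "\<And>n. coeff q n \<in> gen S" "poly q x \<noteq> 0"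
      "f = poly p x / poly q x"
    using gen_insert_quotient[OF f] by blast
  have "poly (p - smult f q) (\<phi> n x) = 0" for n
  proof -
    interpret field_hom "\<phi> n" by (rule hom)
    have "f * poly q x = poly p x"
      using pq by simp
    then have "\<phi> n (f * poly q x) = \<phi> n (poly p x)"
      by simp
    then show ?thesis
      by (simp add: fixed hom_poly_gen[OF pq(1) S] hom_poly_gen[OF pq(2) S])
  qed
  then have "range (\<lambda>n. \<phi> n x) \<subseteq> {y. poly (p - smult f q) y = 0}"
    by blast
  then have "p - smult f q = 0"
    using infinite poly_roots_finite infinite_super by blast
  then have p: "p = smult f q"
    by simp
  \<comment> \<open>One nonzero coefficient of \<open>q\<close> suffices to recover \<open>f\<close>
    as a quotient of two elements of \<open>gen S\<close>.\<close>
  obtain n where "coeff q n \<noteq> 0"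
    using pq(3) by (metis leading_coeff_0_iff poly_0)
  then have "f = coeff p n / coeff q n"
    by (simp add: p)
  then show ?thesis
    using pq gen_divide by metis
qed

text \<open>Adjoining \<open>t\<close> to the empty set gives quotients of polynomials over the
  prime field, whose elements are rational numbers.\<close>

lemma gen_singleton: "gen {t} = adjoin_field t"
proof
  have rat: "\<exists>p'. p = map_poly of_rat p'" if "\<And>n. coeff p n \<in> gen {}" for p
  proof -
    have "f \<in> \<rat>" if "f \<in> gen {}" for f
      using that by (induction rule: gen.induct) auto
    then show ?thesis
      using that by (metis ratpolyE)
  qed
  show "gen {t} \<subseteq> adjoin_field t"
  proof
    fix f assume "f \<in> gen {t}"
    then obtain p q where *: "\<And>n. coeff p n \<in> gen {}" "\<And>n. coeff q n \<in> gen {}" "poly q t \<noteq> 0"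
        "f = poly p t / poly q t"
      using gen_insert_quotient[of f t "{}"] by blast
    then show "f \<in> adjoin_field t"
      using rat[OF *(1)] rat[OF *(2)] by (auto simp: adjoin_field_def const_eq_of_rat[abs_def])
  qed
  have t: "t \<in> gen {t}"
    by (rule gen_base) simp
  have "poly (map_poly of_rat p) t \<in> gen {t}" for p
    by (induction p) (auto simp: map_poly_pCons intro!: gen_intros gen_of_rat t)
  then show "adjoin_field t \<subseteq> gen {t}"
    by (auto simp: adjoin_field_def const_eq_of_rat[abs_def] intro: gen_divide)
qed


section \<open>Laurent polynomials\<close>

lemma laurent_to_fract: "to_fract P \<in> laurent_ring"
  unfolding laurent_ring_def
  by (rule CollectI, rule exI[of _ P], (rule exI[of _ 0])+) simp

lemma laurent_mult:
  assumes "f \<in> laurent_ring" "g \<in> laurent_ring"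
  shows "f * g \<in> laurent_ring"
proof -
  obtain P a b c P' a' b' c' where *: "f = to_fract P / (X 1 ^ a * X 2 ^ b * X 3 ^ c)"
      "g = to_fract P' / (X 1 ^ a' * X 2 ^ b' * X 3 ^ c')"
    using assms unfolding laurent_ring_def by blast
  have "f * g = to_fract (P * P') / (X 1 ^ (a + a') * X 2 ^ (b + b') * X 3 ^ (c + c'))"
    by (simp add: * power_add mult_ac)
  then show ?thesis
    unfolding laurent_ring_def by blast
qed

lemma X_eq_to_fract: "\<exists>P. X i = to_fract P"
  by (auto simp: X_def)

lemma laurent_add:
  assumes "f \<in> laurent_ring" "g \<in> laurent_ring"
  shows "f + g \<in> laurent_ring"
proof -
  obtain P a b c P' a' b' c' where *: "f = to_fract P / (X 1 ^ a * X 2 ^ b * X 3 ^ c)"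
      "g = to_fract P' / (X 1 ^ a' * X 2 ^ b' * X 3 ^ c')"
    using assms unfolding laurent_ring_def by blast
  \<comment> \<open>The monomial denominators are themselves polynomials, so cross multiplication
    yields a polynomial numerator.\<close>
  have pow: "\<exists>P. X i ^ n = to_fract P" for i n
  proof (induction n)
    case 0
    show ?case by (intro exI[of _ 1]) simp
  next
    case (Suc n)
    then show ?case
      using X_eq_to_fract[of i] by (metis power_Suc to_fract_mult)
  qed
  have mon: "\<exists>M. X 1 ^ a * X 2 ^ b * X 3 ^ c = to_fract M" for a b c
    using pow[of 1 a] pow[of 2 b] pow[of 3 c] by (metis to_fract_mult)
  obtain M M' where M: "X 1 ^ a * X 2 ^ b * X 3 ^ c = to_fract M"
      "X 1 ^ a' * X 2 ^ b' * X 3 ^ c' = to_fract M'"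
    using mon by metis
  have "f + g = to_fract (P * M' + P' * M) / (to_fract M * to_fract M')"
    using M[symmetric] by (simp add: * M[symmetric] add_frac_eq)
  also have "to_fract M * to_fract M' = X 1 ^ (a + a') * X 2 ^ (b + b') * X 3 ^ (c + c')"
    by (simp add: M[symmetric] power_add mult_ac)
  finally show ?thesis
    unfolding laurent_ring_def by blast
qed

lemma laurent_of_rat: "of_rat c \<in> laurent_ring"
  using laurent_to_fract[of "[:[:[:c:]:]:]"] by (simp add: const_def flip: const_eq_of_rat)

lemma laurent_0: "0 \<in> laurent_ring" and laurent_1: "1 \<in> laurent_ring"
  using laurent_of_rat[of 0] laurent_of_rat[of 1] by simp_all

lemma laurent_of_nat: "of_nat n \<in> laurent_ring"
  using laurent_of_rat[of "of_nat n"] by simp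

lemma laurent_numeral: "numeral n \<in> laurent_ring"
  using laurent_of_rat[of "numeral n"] by simp

lemma laurent_X: "X i \<in> laurent_ring"
  using X_eq_to_fract[of i] laurent_to_fract by metis

lemma laurent_power: "f \<in> laurent_ring \<Longrightarrow> f ^ n \<in> laurent_ring"
  by (induction n) (auto intro: laurent_1 laurent_mult)

lemma laurent_inverse_X: "inverse (X i) \<in> laurent_ring"
proof -
  have *: "to_fract 1 / (X 1 ^ a * X 2 ^ b * X 3 ^ c) \<in> laurent_ring" for a b c
    unfolding laurent_ring_def by blast
  show ?thesis
    using *[of 1 0 0] *[of 0 1 0] *[of 0 0 1] exhaust_3[of i] by (auto simp: inverse_eq_divide)
qed

lemma laurent_divide_X: "f \<in> laurent_ring \<Longrightarrow> f / X i \<in> laurent_ring"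
  using laurent_mult[OF _ laurent_inverse_X] by (simp add: divide_inverse)

text \<open>As an introduction rule, it lets a monomial denominator be removed one variable at a
  time.\<close>

lemma laurent_divide_mult: "f / g / h \<in> laurent_ring \<Longrightarrow> f / (g * h) \<in> laurent_ring"
  by (simp add: divide_divide_eq_left)

lemmas laurent_intros = laurent_0 laurent_1 laurent_add laurent_mult laurent_power laurent_of_nat
  laurent_numeral laurent_X laurent_divide_X laurent_divide_mult

lemma laurent_has_value:
  assumes "f \<in> laurent_ring" "\<And>i. v i \<noteq> 0"
  obtains c where "has_value v f c"
proof -
  obtain P a b c where *: "f = to_fract P / (X 1 ^ a * X 2 ^ b * X 3 ^ c)"
    using assms unfolding laurent_ring_def by blast
  have "has_value v f (eval3 v P / (v 1 ^ a * v 2 ^ b * v 3 ^ c))"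
    unfolding * using assms(2)
    by (intro has_value_divide has_value_to_fract has_value_intros) auto
  then show thesis
    by (rule that)
qed

text \<open>A nonconstant denominator \<open>q T\<close> in lowest terms vanishes at a point of the complex torus,
  where the Laurent polynomial \<open>f\<close> is defined; so the numerator would vanish there, too.\<close>

lemma adjoin_field_laurent:
  assumes f: "f \<in> adjoin_field T" "f \<in> laurent_ring"
    and torus: "\<And>a :: complex. \<exists>v. (\<forall>l. v l \<noteq> 0) \<and> has_value v T a"
  shows "f \<in> adjoin_ring T"
proof -
  define E where "E = (\<lambda>p t. poly (map_poly (of_rat :: rat \<Rightarrow> ratfun) p) t)"
  have E_mult: "E (p * q) t = E p t * E q t" for p q t
    by (simp add: E_def map_poly_mult_hom of_rat_add of_rat_mult)
  obtain p0 q0 where pq0: "f = E p0 T / E q0 T" "E q0 T \<noteq> 0"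
    using f(1) by (auto simp: adjoin_field_def const_eq_of_rat[abs_def] E_def)
  then have "q0 \<noteq> 0"
    by (auto simp: E_def)
  \<comment> \<open>Reduction to lowest terms takes place in the polynomial ring in one variable
    over the rationals, where Bezout's identity holds.\<close>
  then obtain p q where pq: "p0 = p * gcd p0 q0" "q0 = q * gcd p0 q0" "coprime p q"
    using gcd_coprime_exists[of p0 q0] by auto
  have split: "E p0 T = E p T * E (gcd p0 q0) T" "E q0 T = E q T * E (gcd p0 q0) T"
    using E_mult pq by metis+
  have f_eq: "f = E p T / E q T" "E q T \<noteq> 0"
    using pq0 by (auto simp: split)
  show ?thesis
  proof (cases "degree q = 0")
    case True
    then obtain c where "q = [:c:]"
      by (metis degree_eq_zeroE)
    then have "f = E (smult (1 / c) p) T"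
      using f_eq by (simp add: E_def map_poly_pCons map_poly_smult of_rat_mult of_rat_divide)
    then show ?thesis
      by (auto simp: adjoin_ring_def E_def const_eq_of_rat[abs_def])
  next
    case False
    define C where "C = (\<lambda>p t. poly (map_poly (of_rat :: rat \<Rightarrow> complex) p) t)"
    have C_mult: "C (p * q) t = C p t * C q t" and C_add: "C (p + q) t = C p t + C q t" for p q t
      by (simp_all add: C_def map_poly_mult_hom map_poly_add_hom of_rat_add of_rat_mult)
    have "degree (map_poly (of_rat :: rat \<Rightarrow> complex) q) \<noteq> 0"
      using False by (simp add: degree_map_poly)
    then obtain a where a: "C q a = 0"
      unfolding C_def by (metis constant_degree fundamental_theorem_of_algebra)
    obtain v where v: "\<And>l. v l \<noteq> 0" "has_value v T a"
      using torus by blast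
    obtain c where c: "has_value v f c"
      using laurent_has_value f(2) v(1) by blast
    have "f * E q T = E p T"
      using f_eq by simp
    \<comment> \<open>Two values of the same function at \<open>v\<close>: the first is 0 because
      \<open>C q a = 0\<close>.\<close>
    then have "has_value v (E p T) (c * C q a)" "has_value v (E p T) (C p a)"
      using has_value_mult[OF c has_value_poly[OF v(2), of q]] has_value_poly[OF v(2), of p]
      by (simp_all add: E_def C_def)
    then have "C p a = 0"
      using has_value_unique a by fastforce
    \<comment> \<open>Evaluated at the common root \<open>a\<close>, this identity becomes 0 =
      1.\<close>
    obtain r s where "r * p + s * q = 1"
      using bezout_coefficients_fst_snd[of p q] pq(3) by (metis coprime_imp_gcd_eq_1)
    then have "C r a * C p a + C s a * C q a = C 1 a"
      by (metis C_add C_mult)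
    then show ?thesis
      by (simp add: a \<open>C p a = 0\<close>) (simp add: C_def)
  qed
qed

lemma adjoin_ring_laurent:
  assumes "T \<in> laurent_ring"
  shows "adjoin_ring T \<subseteq> laurent_ring"
proof -
  have "poly (map_poly of_rat p) T \<in> laurent_ring" for p
    by (induction p) (auto simp: map_poly_pCons intro!: laurent_intros laurent_of_rat assms)
  then show ?thesis
    by (auto simp: adjoin_ring_def const_eq_of_rat[abs_def])
qed

lemma adjoin_ring_subset_field: "adjoin_ring T \<subseteq> adjoin_field T"
proof
  fix f assume "f \<in> adjoin_ring T"
  then obtain p where "f = poly (map_poly const p) T"
    by (auto simp: adjoin_ring_def)
  then show "f \<in> adjoin_field T"
    unfolding adjoin_field_def by (intro CollectI exI[of _ p] exI[of _ 1]) simp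
qed


section \<open>Exchange relations with an infinite dihedral action\<close>

text \<open>At the point (1,1,1), \<open>A\<close> exceeds the \<open>p\<close>-th power of
  \<open>X j\<close>. Quantifying over \<open>\<psi>\<close> lets the same estimate be applied at
  every stage of an orbit that fixes \<open>X k\<close>.\<close>

definition growing :: "ratfun \<Rightarrow> 3 \<Rightarrow> 3 \<Rightarrow> nat \<Rightarrow> bool" where
  "growing A j k p \<longleftrightarrow> (\<forall>\<psi> s. field_hom \<psi> \<and> \<psi> (X k) = X k \<and> 0 < s \<and>
     has_value (\<lambda>_. 1 :: real) (\<psi> (X j)) s \<longrightarrow>
     (\<exists>r > s ^ p. has_value (\<lambda>_. 1 :: real) (\<psi> A) r))"

lemma growing_value_1:
  assumes "growing A j k p"
  shows "\<exists>r > 1. has_value (\<lambda>_. 1 :: real) A r"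
proof -
  have "field_hom id"
    by unfold_locales simp_all
  then show ?thesis
    using assms has_value_X[of "\<lambda>_. 1 :: real" j] unfolding growing_def
    by (metis id_apply power_one zero_less_one)
qed

text \<open>With \<open>t' = r / t\<close> and \<open>s' = r' / s\<close>, the condition \<open>t\<^sup>2 \<le> s ^ p\<close> reproduces itself and makes
  the second coordinate increase.\<close>

lemma growth_step:
  fixes s t r r' :: real
  assumes "p * q = 4" "0 < s" "0 < t" "t\<^sup>2 \<le> s ^ p" "r > s ^ p" "r' > (r / t) ^ q"
  shows "r / t > 0" "r' / s > s" "(r / t)\<^sup>2 \<le> (r' / s) ^ p"
proof -
  define t' where "t' = r / t"
  have p: "0 < p" and q: "0 < q"
    using assms(1) by (auto intro: Nat.gr0I)
  have "0 < s ^ p"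
    using assms by simp
  then have "0 < r"
    using assms by linarith
  then have t': "0 < t'"
    using assms by (simp add: t'_def)
  then show "r / t > 0"
    by (simp add: t'_def)
  have "s ^ p * t\<^sup>2 \<le> s ^ p * s ^ p"
    using assms by (intro mult_left_mono) auto
  also have "\<dots> < r * r"
    using assms \<open>0 < s ^ p\<close> by (intro mult_strict_mono') auto
  finally have 1: "s ^ p < t'\<^sup>2"
    using \<open>0 < t\<close> by (simp add: t'_def power_divide pos_less_divide_eq power2_eq_square)
  \<comment> \<open>By \<open>p * q = 4\<close> the left side is the fourth power of
    \<open>s\<close>; a square root then gives the bound against \<open>t' ^ q\<close>.\<close>
  have "(s ^ p) ^ q < (t'\<^sup>2) ^ q"
    using 1 q \<open>0 < s ^ p\<close> by (intro power_strict_mono) auto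
  then have "(s\<^sup>2)\<^sup>2 < (t' ^ q)\<^sup>2"
    using assms(1) by (simp add: mult.commute flip: power_mult)
  then have 2: "s\<^sup>2 < t' ^ q"
    by (rule power_less_imp_less_base) (use t' in simp)
  then have 3: "s\<^sup>2 < r'"
    using assms by (simp add: t'_def)
  then show "r' / s > s"
    using assms by (simp add: pos_less_divide_eq power2_eq_square)
  have "t' ^ q * s\<^sup>2 \<le> t' ^ q * t' ^ q"
    using 2 t' by (intro mult_left_mono) auto
  also have "\<dots> < r' * r'"
    using assms t' by (intro mult_strict_mono') (auto simp: t'_def)
  finally have 4: "t' ^ q < (r' / s)\<^sup>2"
    using assms by (simp add: power_divide pos_less_divide_eq power2_eq_square)
  have "0 < r'"
    using 3 by (smt (verit) zero_le_power2)
  \<comment> \<open>The same device with \<open>p\<close> in place of \<open>q\<close> restores the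
    invariant for the new pair.\<close>
  have "(t' ^ q) ^ p < ((r' / s)\<^sup>2) ^ p"
    using 4 t' p by (intro power_strict_mono) auto
  then have "(t'\<^sup>2)\<^sup>2 < ((r' / s) ^ p)\<^sup>2"
    using assms(1) by (simp add: mult.commute flip: power_mult)
  then have "t'\<^sup>2 < (r' / s) ^ p"
    by (rule power_less_imp_less_base) (use \<open>0 < r'\<close> \<open>0 < s\<close> in simp)
  then show "(r / t)\<^sup>2 \<le> (r' / s) ^ p"
    by (simp add: t'_def)
qed

text \<open>Common properties of all the cases. \<open>A l\<close> is the exchange polynomial, and
  \<open>A_value\<close> expresses that it does not involve \<open>X l\<close>.
  \<open>X l + A l / X l\<close> is the trace of \<open>X l\<close> under the mutation at
  \<open>l\<close>. The index \<open>i\<close> is distinguished: \<open>X i\<close> has degree at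
  most two over the field generated by \<open>T\<close>, \<open>X j\<close>, \<open>X k\<close>, and
  the two orbits used come from the pairs \<open>i\<close>, \<open>j\<close> and \<open>i\<close>,
  \<open>k\<close>.\<close>

locale exchange =
  fixes m :: "3 \<Rightarrow> 3 \<Rightarrow> ratfun" and A :: "3 \<Rightarrow> ratfun" and T :: ratfun and i j k :: 3
    and p q p' q' :: nat
  assumes distinct: "i \<noteq> j" "i \<noteq> k" "j \<noteq> k"
    and m: "m l = X(l := A l / X l)"
    and A_value: "has_value (m l) (A l) (A l)"
    and A_gen: "A i \<in> gen {X j, X k}"
    and T_gen: "T \<in> gen (insert (X l + A l / X l) (X ` (- {l})))"
    and trace_gen: "X i + A i / X i \<in> gen {T, X j, X k}"
    and growing: "growing (A i) j k p" "growing (A j) i k q" "p * q = 4"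
      "growing (A i) k j p'" "growing (A k) i j q'" "p' * q' = 4"
    and T_laurent: "T \<in> laurent_ring"
    and T_torus: "\<exists>v. (\<forall>l. v l \<noteq> 0) \<and> has_value v T (a :: complex)"
begin

section \<open>Mutations as involutions fixing \<open>T\<close>\<close>

abbreviation \<mu> where "\<mu> l \<equiv> subst (m l)"

lemma exhaust: "l = i \<or> l = j \<or> l = k"
  using distinct exhaust_3[of i] exhaust_3[of j] exhaust_3[of k] exhaust_3[of l] by metis

lemma A_nonzero: "A l \<noteq> 0"
proof
  assume "A l = 0"
  moreover obtain r where "r > 1" "has_value (\<lambda>_. 1 :: real) (A l) r"
    \<comment> \<open>The facts 1, 2 and 5 concern \<open>A i\<close>, \<open>A j\<close> and
      \<open>A k\<close> respectively.\<close>
    using exhaust[of l] growing(1,2,5)[THEN growing_value_1] by blast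
  ultimately show False
    using has_value_unique[OF has_value_0] by fastforce
qed

lemma m_simps: "m l l = A l / X l" "n \<noteq> l \<Longrightarrow> m l n = X n"
  by (simp_all add: m)

text \<open>Mutating at \<open>l\<close> leaves \<open>A l\<close> unchanged, so
  \<open>A l / X l\<close> goes back to \<open>X l\<close>. This is the hypothesis of
  \<open>field_hom_subst\<close>.\<close>

lemma m_involution: "has_value (m l) (m l n) (X n)"
proof (cases "n = l")
  case True
  have "has_value (m l) (A l / X l) (A l / (A l / X l))"
    using has_value_X[of "m l" l] A_nonzero[of l]
    by (intro has_value_divide A_value) (auto simp: m_simps)
  then show ?thesis
    using A_nonzero[of l] by (simp add: True m_simps)
next
  case False
  then show ?thesis
    using has_value_X[of "m l" n] by (simp add: m_simps)
qed

lemma field_hom_\<mu>: "field_hom (\<mu> l)"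
  by (rule field_hom_subst m_involution)+

lemma \<mu>_X: "\<mu> l (X l) = A l / X l" "n \<noteq> l \<Longrightarrow> \<mu> l (X n) = X n"
  using field_hom_subst(2)[OF m_involution] by (simp_all add: m_simps)

lemma \<mu>_A: "\<mu> l (A l) = A l"
  by (rule subst_has_value[OF A_value])

text \<open>\<open>T\<close> lies in a field whose generators are fixed: the mutation swaps the two
  summands of the trace and leaves the other variables alone.\<close>

lemma \<mu>_T: "\<mu> l T = T"
proof -
  interpret field_hom "\<mu> l" by (rule field_hom_\<mu>)
  show ?thesis
  proof (rule hom_gen_id[OF T_gen[of l]])
    fix g assume "g \<in> insert (X l + A l / X l) (X ` (- {l}))"
    then consider "g = X l + A l / X l" | n where "n \<noteq> l" "g = X n"
      by blast
    then show "\<mu> l g = g"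
      using A_nonzero[of l] by cases (simp_all add: \<mu>_X \<mu>_A)
  qed
qed

text \<open>The orbit elements are told apart by their values at (1,1,1), which
  \<open>growth_step\<close> shows to be strictly increasing.\<close>

lemma orbit_infinite:
  assumes abc: "a \<noteq> b" "a \<noteq> c" "b \<noteq> c"
    and grow: "growing (A a) b c d" "growing (A b) a c e" "d * e = 4"
  shows "infinite (range (\<lambda>n. ((\<mu> a \<circ> \<mu> b) ^^ n) (X b)))"
proof -
  define \<sigma> where "\<sigma> n = (\<mu> a \<circ> \<mu> b) ^^ n" for n
  have hom_ab: "field_hom (\<mu> a \<circ> \<mu> b)"
    by (intro field_hom_comp field_hom_\<mu>)
  have hom: "field_hom (\<sigma> n)" for n
    unfolding \<sigma>_def by (intro field_hom_funpow hom_ab)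
  interpret a: field_hom "\<mu> a" by (rule field_hom_\<mu>)
  interpret b: field_hom "\<mu> b" by (rule field_hom_\<mu>)
  \<comment> \<open>The new pair of mutations acts first, so the explicit formulas for one mutation
    can be pushed through the homomorphism \<open>\<sigma> n\<close>.\<close>
  have Suc: "\<sigma> (Suc n) f = \<sigma> n (\<mu> a (\<mu> b f))" for n f
    by (simp only: \<sigma>_def funpow_Suc_right comp_def)
  have fix_c: "\<sigma> n (X c) = X c" for n
    by (induction n) (use abc in \<open>simp_all add: Suc \<mu>_X\<close>, simp add: \<sigma>_def)
  have Suc_a: "\<sigma> (Suc n) (X a) = \<sigma> n (A a) / \<sigma> n (X a)" for n
  proof -
    interpret s: field_hom "\<sigma> n" by (rule hom)
    show ?thesis
      using abc by (simp add: Suc \<mu>_X)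
  qed
  have Suc_b: "\<sigma> (Suc n) (X b) = \<sigma> n (\<mu> a (A b)) / \<sigma> n (X b)" for n
  proof -
    interpret s: field_hom "\<sigma> n" by (rule hom)
    show ?thesis
      using abc by (simp add: Suc \<mu>_X)
  qed
  \<comment> \<open>The state records the current values of both moving variables with the
    inequality that \<open>growth_step\<close> reproduces.\<close>
  define P where "P n x \<longleftrightarrow> (case x of (t, s) \<Rightarrow> 0 < t \<and> 0 < s \<and> t\<^sup>2 \<le> s ^ d \<and>
      has_value (\<lambda>_. 1 :: real) (\<sigma> n (X a)) t \<and> has_value (\<lambda>_. 1 :: real) (\<sigma> n (X b)) s)"
    for n x
  have start: "P 0 (1, 1)"
    using has_value_X[of "\<lambda>_. 1 :: real"] by (simp add: P_def \<sigma>_def)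
  have step: "\<exists>y. P (Suc n) y \<and> snd x < snd y" if "P n x" for n x
  proof -
    obtain t s where x: "x = (t, s)" by (cases x)
    have ts: "0 < t" "0 < s" "t\<^sup>2 \<le> s ^ d" "has_value (\<lambda>_. 1) (\<sigma> n (X a)) t"
        "has_value (\<lambda>_. 1) (\<sigma> n (X b)) s"
      using that by (auto simp: P_def x)
    obtain r where r: "r > s ^ d" "has_value (\<lambda>_. 1) (\<sigma> n (A a)) r"
      using grow(1) hom fix_c ts unfolding growing_def by blast
    have "0 < s ^ d"
      using ts by simp
    then have "r / t > 0"
      using r(1) ts by (intro divide_pos_pos) linarith+
    have value_a: "has_value (\<lambda>_. 1) (\<sigma> (Suc n) (X a)) (r / t)"
      unfolding Suc_a using r ts by (intro has_value_divide) auto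
    \<comment> \<open>Since \<open>\<mu> b\<close> fixes \<open>X a\<close>, this half step already
      sends \<open>X a\<close> to its next orbit element, whose value bounds \<open>A b\<close> from
      below.\<close>
    have "field_hom (\<sigma> n \<circ> \<mu> a)" "(\<sigma> n \<circ> \<mu> a) (X c) = X c"
        "(\<sigma> n \<circ> \<mu> a) (X a) = \<sigma> (Suc n) (X a)"
      using field_hom_comp hom field_hom_\<mu> abc fix_c by (simp_all add: \<mu>_X Suc)
    then obtain r' where r': "r' > (r / t) ^ e" "has_value (\<lambda>_. 1) ((\<sigma> n \<circ> \<mu> a) (A b)) r'"
      using grow(2) value_a \<open>r / t > 0\<close> unfolding growing_def by metis
    have value_b: "has_value (\<lambda>_. 1) (\<sigma> (Suc n) (X b)) (r' / s)"
      unfolding Suc_b using r' ts by (intro has_value_divide) auto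
    note growth_step[OF grow(3) ts(2,1,3) r(1) r'(1)]
    then have "P (Suc n) (r / t, r' / s)" "s < r' / s"
      using value_a value_b ts by (auto simp: P_def)
    then show ?thesis
      by (intro exI[of _ "(r / t, r' / s)"]) (simp add: x)
  qed
  obtain w where w: "\<And>n. P n (w n)" "\<And>n. snd (w n) < snd (w (Suc n))"
    using dependent_nat_choice[of P "\<lambda>_ x y. snd x < snd y"] start step by metis
  have "inj (\<lambda>n. \<sigma> n (X b))"
  proof (rule injI)
    fix n n' assume eq: "\<sigma> n (X b) = \<sigma> n' (X b)"
    have "has_value (\<lambda>_. 1) (\<sigma> n (X b)) (snd (w n))" for n
      using w(1)[of n] by (simp add: P_def split: prod.splits)
    from this[of n] this[of n'] have "snd (w n) = snd (w n')"
      using has_value_unique eq by metis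
    moreover have "strict_mono (\<lambda>n. snd (w n))"
      using w(2) by (simp add: strict_mono_Suc_iff)
    ultimately show "n = n'"
      by (metis injD strict_mono_imp_inj_on)
  qed
  then show ?thesis
    using range_inj_infinite by (simp add: \<sigma>_def)
qed

text \<open>Such expressions form a field: the quadratic equation of \<open>X i\<close> reduces
  squares, and a divisor is made free of \<open>X i\<close> by multiplying with its
  conjugate.\<close>

lemma degree_two: "\<exists>u \<in> gen {T, X j, X k}. \<exists>v \<in> gen {T, X j, X k}. f = u + v * X i"
proof -
  define E where "E = gen {T, X j, X k}"
  define s where "s = X i + A i / X i"
  have E: "s \<in> E" "A i \<in> E"
    using trace_gen gen_trans[OF A_gen, of "{T, X j, X k}"] by (auto simp: E_def s_def gen_base)
  have E_ops: "u + v \<in> E" "u - v \<in> E" "u * v \<in> E" "u / v \<in> E" if "u \<in> E" "v \<in> E" for u v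
    using that by (auto simp: E_def intro: gen_intros)
  have E_01: "0 \<in> E" "1 \<in> E"
    by (auto simp: E_def intro: gen_intros)
  interpret field_hom "\<mu> i" by (rule field_hom_\<mu>)
  have conj: "\<mu> i (X i) = s - X i"
    by (simp add: \<mu>_X s_def)
  have \<mu>_E: "\<mu> i g = g" if "g \<in> E" for g
    using that distinct by (auto intro!: hom_gen_id[of g "{T, X j, X k}"] simp: E_def \<mu>_X \<mu>_T)
  have square: "X i * X i = s * X i - A i"
    by (simp add: s_def field_simps)
  have "f \<in> gen (range X)"
    by (rule gen_range_X)
  then have "\<exists>u \<in> E. \<exists>v \<in> E. f = u + v * X i"
  proof (induction rule: gen.induct)
    case (gen_base f)
    then obtain l where l: "f = X l" by blast
    show ?case
    proof (cases "l = i")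
      case True
      then show ?thesis
        using E_01 l by (intro bexI[of _ 0] bexI[of _ 1]) simp_all
    next
      case False
      then have "l = j \<or> l = k"
        using exhaust[of l] by blast
      then have "f \<in> E"
        by (auto simp: l E_def intro: gen.gen_base)
      then show ?thesis
        using E_01 by (intro bexI[of _ f] bexI[of _ 0]) simp_all
    qed
  next
    case gen_1
    then show ?case
      using E_01 by (intro bexI[of _ 1] bexI[of _ 0]) simp_all
  next
    case (gen_diff f g)
    then obtain u v u' v' where *: "u \<in> E" "v \<in> E" "f = u + v * X i"
        "u' \<in> E" "v' \<in> E" "g = u' + v' * X i"
      by metis
    then show ?case
      using E_ops by (intro bexI[of _ "u - u'"] bexI[of _ "v - v'"]) (simp_all add: algebra_simps)
  next
    case (gen_divide f g)
    then obtain u v u' v' where *: "u \<in> E" "v \<in> E" "f = u + v * X i"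
        "u' \<in> E" "v' \<in> E" "g = u' + v' * X i"
      by metis
    show ?case
    proof (cases "g = 0")
      case True
      then show ?thesis
        using E_01 by (intro bexI[of _ 0]) simp_all
    next
      case False
      \<comment> \<open>The norm of \<open>g\<close>, which lies in \<open>E\<close>.\<close>
      define N where "N = g * \<mu> i g"
      have "\<mu> i g = u' + v' * (s - X i)"
        using * by (simp add: \<mu>_E conj)
      then have \<mu>_g: "\<mu> i g = (u' + v' * s) - v' * X i"
        by (simp add: algebra_simps)
      have "N = u' * u' + u' * v' * s + v' * v' * (s * X i - X i * X i)"
        unfolding N_def \<mu>_g using * by (simp add: algebra_simps)
      then have N: "N = u' * u' + u' * v' * s + v' * v' * A i"
        by (simp add: square)
      have "f * \<mu> i g = u * (u' + v' * s) + (v * (u' + v' * s) - u * v') * X i - v * v' * (X i * X i)"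
        unfolding \<mu>_g using * by (simp add: algebra_simps)
      then have num: "f * \<mu> i g = (u * (u' + v' * s) + v * v' * A i)
          + (v * (u' + v' * s) - u * v' - v * v' * s) * X i"
        unfolding square by (simp add: algebra_simps)
      have "N \<in> E"
        using * E E_ops by (simp add: N)
      have "f / g = (f * \<mu> i g) / N"
        using False by (simp add: N_def)
      also have "\<dots> = (u * (u' + v' * s) + v * v' * A i) / N
          + (v * (u' + v' * s) - u * v' - v * v' * s) / N * X i"
        unfolding num by (simp add: add_divide_distrib)
      finally show ?thesis
        using * E E_ops \<open>N \<in> E\<close>
        by (intro bexI[of _ "(u * (u' + v' * s) + v * v' * A i) / N"]
            bexI[of _ "(v * (u' + v' * s) - u * v' - v * v' * s) / N"]) simp_all
    qed
  qed
  then show ?thesis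
    by (simp add: E_def)
qed

text \<open>At (1,1,1) the left side has value 1 and the right side a value greater than 1.\<close>

lemma X_conjugate_neq: "X i \<noteq> A i / X i"
proof
  assume eq: "X i = A i / X i"
  have X_value: "has_value (\<lambda>_. 1 :: real) (X l) 1" for l
    using has_value_X[of "\<lambda>_. 1 :: real" l] by simp
  obtain r where r: "r > 1" "has_value (\<lambda>_. 1 :: real) (A i) r"
    using growing_value_1[OF growing(1)] by blast
  have "has_value (\<lambda>_. 1 :: real) (A i / X i) (r / 1)"
    by (intro has_value_divide r X_value) simp
  then have "r = 1"
    using has_value_unique[OF X_value[of i]] eq by fastforce
  then show False
    using r by simp
qed

lemma invariant_field_eq: "invariant_field m = adjoin_field T"
proof
  show "adjoin_field T \<subseteq> invariant_field m"
    using field_hom.hom_gen_id[OF field_hom_\<mu>, of _ "{T}"] \<mu>_T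
    by (auto simp: invariant_field_def simp flip: gen_singleton)
  show "invariant_field m \<subseteq> adjoin_field T"
  proof
    fix f assume "f \<in> invariant_field m"
    then have f: "\<mu> l f = f" for l
      by (simp add: invariant_field_def)
    obtain u v where uv: "u \<in> gen {T, X j, X k}" "v \<in> gen {T, X j, X k}" "f = u + v * X i"
      using degree_two by blast
    interpret field_hom "\<mu> i" by (rule field_hom_\<mu>)
    have "\<mu> i g = g" if "g \<in> gen {T, X j, X k}" for g
      using that distinct by (auto intro!: hom_gen_id[of g "{T, X j, X k}"] simp: \<mu>_X \<mu>_T)
    then have "\<mu> i f = u + v * (A i / X i)"
      using uv by (simp add: \<mu>_X)
    \<comment> \<open>Subtracting the conjugate of \<open>f\<close> from \<open>f\<close> isolates
      the coefficient of \<open>X i\<close>.\<close>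
    then have "v * (X i - A i / X i) = 0"
      using f[of i] uv(3) by (simp add: algebra_simps)
    then have "v = 0"
      using X_conjugate_neq by simp
    then have "f \<in> gen (insert (X j) {T, X k})"
      using uv by (simp add: insert_commute)
    have funpow_fixed: "((\<mu> a \<circ> \<mu> b) ^^ n) g = g" if "\<mu> a g = g" "\<mu> b g = g" for a b n g
      using that by (induction n) auto
    have hom: "field_hom ((\<mu> a \<circ> \<mu> b) ^^ n)" for a b n
      by (intro field_hom_funpow field_hom_comp field_hom_\<mu>)
    \<comment> \<open>\<open>X j\<close> is eliminated by an orbit that fixes \<open>X k\<close>;
      afterwards \<open>X k\<close> is eliminated by the orbit from \<open>i\<close> and
      \<open>k\<close>, along which only \<open>f\<close> and \<open>T\<close> must be
      fixed.\<close>
    have "f \<in> gen {T, X k}"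
    proof (rule gen_descend[OF \<open>f \<in> gen (insert (X j) {T, X k})\<close> hom])
      show "infinite (range (\<lambda>n. ((\<mu> i \<circ> \<mu> j) ^^ n) (X j)))"
        using distinct by (intro orbit_infinite[OF _ _ _ growing(1-3)]) auto
    qed (use distinct in \<open>auto intro!: funpow_fixed simp: f \<mu>_T \<mu>_X\<close>)
    then have "f \<in> gen (insert (X k) {T})"
      by (simp add: insert_commute)
    then have "f \<in> gen {T}"
    proof (rule gen_descend[OF _ hom])
      show "infinite (range (\<lambda>n. ((\<mu> i \<circ> \<mu> k) ^^ n) (X k)))"
        using distinct by (intro orbit_infinite[OF _ _ _ growing(4-6)]) auto
    qed (auto intro!: funpow_fixed simp: f \<mu>_T)
    then show "f \<in> adjoin_field T"
      by (simp add: gen_singleton)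
  qed
qed

lemma laurent_invariants_eq: "invariant_field m \<inter> laurent_ring = adjoin_ring T"
  using adjoin_field_laurent[OF _ _ T_torus] adjoin_ring_subset_field adjoin_ring_laurent[OF T_laurent]
  by (auto simp: invariant_field_eq)

end


section \<open>The four exchange relations\<close>

lemma growingI:
  assumes "\<And>\<psi> s. field_hom \<psi> \<Longrightarrow> \<psi> (X k) = X k \<Longrightarrow> 0 < s \<Longrightarrow>
    has_value (\<lambda>_. 1 :: real) (\<psi> (X j)) s \<Longrightarrow> has_value (\<lambda>_. 1 :: real) (X k) 1 \<Longrightarrow>
    \<exists>r > s ^ p. has_value (\<lambda>_. 1 :: real) (\<psi> A) r"
  shows "growing A j k p"
  using assms has_value_X[of "\<lambda>_. 1 :: real" k] unfolding growing_def by blast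

text \<open>The excess over the square of \<open>s\<close> is \<open>of_nat n * s + 1\<close>, which
  is positive.\<close>

lemma growing_quadratic: "growing (X j ^ 2 + of_nat n * X j * X k + X k ^ 2) j k 2"
proof (rule growingI)
  fix \<psi> s assume \<psi>: "field_hom \<psi>" "\<psi> (X k) = X k" "0 < s"
    "has_value (\<lambda>_. 1 :: real) (\<psi> (X j)) s" "has_value (\<lambda>_. 1 :: real) (X k) 1"
  interpret field_hom \<psi> by (rule \<psi>)
  have "has_value (\<lambda>_. 1) (\<psi> (X j) ^ 2 + of_nat n * \<psi> (X j) * X k + X k ^ 2)
      (s ^ 2 + of_nat n * s * 1 + 1 ^ 2)"
    by (intro has_value_add has_value_mult has_value_power has_value_of_nat \<psi>)
  moreover have "s ^ 2 < s ^ 2 + of_nat n * s * 1 + 1 ^ 2"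
    using \<psi>(3) by (simp add: add_nonneg_pos)
  ultimately show "\<exists>r > s ^ 2. has_value (\<lambda>_. 1) (\<psi> (X j ^ 2 + of_nat n * X j * X k + X k ^ 2)) r"
    unfolding hom_add hom_mult hom_power hom_of_nat \<psi>(2) by blast
qed

lemma growing_power: "growing (X j ^ p + X k ^ n) j k p"
proof (rule growingI)
  fix \<psi> s assume \<psi>: "field_hom \<psi>" "\<psi> (X k) = X k" "0 < s"
    "has_value (\<lambda>_. 1 :: real) (\<psi> (X j)) s" "has_value (\<lambda>_. 1 :: real) (X k) 1"
  interpret field_hom \<psi> by (rule \<psi>)
  have "has_value (\<lambda>_. 1) (\<psi> (X j) ^ p + X k ^ n) (s ^ p + 1 ^ n)"
    by (intro has_value_add has_value_power \<psi>)
  then show "\<exists>r > s ^ p. has_value (\<lambda>_. 1) (\<psi> (X j ^ p + X k ^ n)) r"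
    using \<psi>(2) by (intro exI[of _ "s ^ p + 1 ^ n"]) simp
qed

lemma exists_nonzero_root:
  assumes "d \<noteq> (0 :: complex)"
  shows "\<exists>x. x \<noteq> 0 \<and> x ^ 2 + e * x + d = 0"
proof -
  obtain x where x: "poly [:d, e, 1:] x = 0"
    using fundamental_theorem_of_algebra[of "[:d, e, 1:]"] by (auto simp: constant_degree)
  have "x \<noteq> 0"
    using x assms by (intro notI) simp
  moreover have "poly [:d, e, 1:] x = x ^ 2 + e * x + d"
    by (simp add: algebra_simps power2_eq_square)
  ultimately show ?thesis
    using x by metis
qed

text \<open>The indices stay arbitrary, so permuted variables are covered by instantiation.\<close>

context
  fixes m :: "3 \<Rightarrow> 3 \<Rightarrow> ratfun" and A :: "3 \<Rightarrow> ratfun" and i j k :: 3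
  assumes distinct: "i \<noteq> j" "i \<noteq> k" "j \<noteq> k"
    and m: "\<And>l. m l = X(l := A l / X l)"
begin

lemma index_cases: "l = i \<or> l = j \<or> l = k"
  using distinct exhaust_3[of i] exhaust_3[of j] exhaust_3[of k] exhaust_3[of l] by metis

lemma has_value_m: "n \<noteq> l \<Longrightarrow> has_value (m l) (X n) (X n)"
  using has_value_X[of "m l" n] by (simp add: m)

lemma gen_X: "n \<noteq> l \<Longrightarrow> X n \<in> gen (insert s (X ` (- {l})))"
  and gen_trace: "s \<in> gen (insert s S)"
  by (rule gen_base, simp)+

text \<open>All coordinates except the \<open>i\<close>-th are set to 1; prescribing the value of
  \<open>T\<close> then becomes a quadratic equation for the remaining one.\<close>

lemma torusI:
  fixes a :: complex
  assumes "d \<noteq> 0"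
    and "\<And>x. x \<noteq> 0 \<Longrightarrow> x ^ 2 + e * x + d = 0 \<Longrightarrow> has_value ((\<lambda>_. 1)(i := x)) T a"
  shows "\<exists>v. (\<forall>l. v l \<noteq> 0) \<and> has_value v T a"
proof -
  obtain x where "x \<noteq> 0" "x ^ 2 + e * x + d = 0"
    using exists_nonzero_root[OF assms(1)] by blast
  then show ?thesis
    using assms(2)[of x] by (intro exI[of _ "(\<lambda>_. 1)(i := x)"] conjI allI) simp_all
qed

lemma exchange_hat:
  assumes A: "A i = X j ^ 2 + of_nat a * X j * X k + X k ^ 2"
      "A j = X i ^ 2 + of_nat b * X i * X k + X k ^ 2"
      "A k = X i ^ 2 + of_nat c * X i * X j + X j ^ 2"
    and T: "T = (X i ^ 2 + X j ^ 2 + X k ^ 2 + of_nat a * X j * X k + of_nat b * X i * X k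
        + of_nat c * X i * X j) / (X i * X j * X k)"
  shows "exchange m A T i j k 2 2 2 2"
proof
  show "has_value (m l) (A l) (A l)" for l
    using index_cases[of l] distinct
    by (auto simp: A intro!: has_value_add has_value_mult has_value_power has_value_of_nat has_value_m)
  show "A i \<in> gen {X j, X k}"
    unfolding A by (intro gen_intros) (auto intro: gen_base)
  show "T \<in> gen (insert (X l + A l / X l) (X ` (- {l})))" for l
  proof -
    define s where "s = X l + A l / X l"
    consider "l = i" | "l = j" | "l = k"
      using index_cases by blast
    then have "T \<in> gen (insert s (X ` (- {l})))"
    proof cases
      case 1
      have "T = (s + of_nat b * X k + of_nat c * X j) / (X j * X k)"
        by (simp add: s_def 1 T A field_simps power2_eq_square)
      then show ?thesis
        using distinct by (simp only: 1) (intro gen_intros gen_X gen_trace; simp)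
    next
      case 2
      have "T = (s + of_nat a * X k + of_nat c * X i) / (X i * X k)"
        by (simp add: s_def 2 T A field_simps power2_eq_square)
      then show ?thesis
        using distinct by (simp only: 2) (intro gen_intros gen_X gen_trace; simp)
    next
      case 3
      have "T = (s + of_nat a * X j + of_nat b * X i) / (X i * X j)"
        by (simp add: s_def 3 T A field_simps power2_eq_square)
      then show ?thesis
        using distinct by (simp only: 3) (intro gen_intros gen_X gen_trace; simp)
    qed
    then show ?thesis
      by (simp only: s_def)
  qed
  have "X i + A i / X i = T * X j * X k - of_nat b * X k - of_nat c * X j"
    by (simp add: T A field_simps power2_eq_square)
  also have "\<dots> \<in> gen {T, X j, X k}"
    by (intro gen_intros) (auto intro: gen_base)
  finally show "X i + A i / X i \<in> gen {T, X j, X k}" .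
  show "growing (A i) j k 2" "growing (A j) i k 2" "growing (A k) i j 2"
    unfolding A by (rule growing_quadratic)+
  show "growing (A i) k j 2"
    using growing_quadratic[of k a j] by (simp add: A add_ac mult_ac)
  show "T \<in> laurent_ring"
    unfolding T by (intro laurent_intros)
  show "\<exists>v. (\<forall>l. v l \<noteq> 0) \<and> has_value v T t" for t :: complex
  proof (rule torusI)
    \<comment> \<open>With \<open>X i = x\<close> and the other variables 1, clearing the
      denominator in \<open>T = t\<close> gives a monic quadratic with this constant term.\<close>
    show "of_nat a + 2 \<noteq> (0 :: complex)"
      by (metis add_is_0 of_nat_0_eq_iff of_nat_add of_nat_numeral zero_neq_numeral)
    fix x :: complex
    assume x: "x \<noteq> 0" "x ^ 2 + (of_nat b + of_nat c - t) * x + (of_nat a + 2) = 0"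
    have tx: "t * x = x ^ 2 + (of_nat b + of_nat c) * x + of_nat a + 2"
      using x(2) by algebra
    define v where "v = (\<lambda>_. 1)(i := x)"
    have v: "v i = x" "v j = 1" "v k = 1"
      using distinct by (auto simp: v_def)
    have "has_value v T ((v i ^ 2 + v j ^ 2 + v k ^ 2 + of_nat a * v j * v k + of_nat b * v i * v k
        + of_nat c * v i * v j) / (v i * v j * v k))"
      unfolding T using x by (intro has_value_divide has_value_intros) (auto simp: v)
    also have "(v i ^ 2 + v j ^ 2 + v k ^ 2 + of_nat a * v j * v k + of_nat b * v i * v k
        + of_nat c * v i * v j) / (v i * v j * v k) = t * x / x"
      unfolding tx v by (simp add: algebra_simps)
    also have "\<dots> = t"
      using x(1) by simp
    finally show "has_value ((\<lambda>_. 1)(i := x)) T t"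
      by (simp only: v_def)
  qed
qed (use distinct m in auto)

text \<open>\<open>T\<close> is affine in the trace of \<open>X i\<close> but involves the squares
  of the traces of \<open>X j\<close> and \<open>X k\<close>, so \<open>i\<close> is the index of
  the first variable. Both growth pairs have exponents 4 and 1.\<close>

lemma exchange_B2:
  assumes A: "A i = X j ^ 4 + X k ^ 4" "A j = X i + X k ^ 2" "A k = X i + X j ^ 2"
    and T: "T = (X i ^ 2 + X j ^ 4 + X k ^ 4 + 2 * X i * X j ^ 2 + 2 * X i * X k ^ 2)
        / (X i * X j ^ 2 * X k ^ 2)"
  shows "exchange m A T i j k 4 1 4 1"
proof
  show "has_value (m l) (A l) (A l)" for l
    using index_cases[of l] distinct
    by (auto simp: A intro!: has_value_add has_value_power has_value_m)
  show "A i \<in> gen {X j, X k}"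
    unfolding A by (intro gen_intros) (auto intro: gen_base)
  show "T \<in> gen (insert (X l + A l / X l) (X ` (- {l})))" for l
  proof -
    define s where "s = X l + A l / X l"
    consider "l = i" | "l = j" | "l = k"
      using index_cases by blast
    then have "T \<in> gen (insert s (X ` (- {l})))"
    proof cases
      case 1
      have "T = (s + 2 * X j ^ 2 + 2 * X k ^ 2) / (X j ^ 2 * X k ^ 2)"
        by (simp add: s_def 1 T A field_simps power2_eq_square)
      then show ?thesis
        using distinct by (simp only: 1) (intro gen_intros gen_X gen_trace; simp)
    next
      case 2
      \<comment> \<open>Squaring the trace produces the cross term \<open>2 * A j\<close>; its part
        in \<open>X k\<close> is not in \<open>T\<close> and is subtracted.\<close>
      have "T = (s ^ 2 - 2 * X k ^ 2) / (X i * X k ^ 2)"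
        by (simp add: s_def 2 T A field_simps power2_eq_square power4_eq_xxxx)
      then show ?thesis
        using distinct by (simp only: 2) (intro gen_intros gen_X gen_trace; simp)
    next
      case 3
      have "T = (s ^ 2 - 2 * X j ^ 2) / (X i * X j ^ 2)"
        by (simp add: s_def 3 T A field_simps power2_eq_square power4_eq_xxxx)
      then show ?thesis
        using distinct by (simp only: 3) (intro gen_intros gen_X gen_trace; simp)
    qed
    then show ?thesis
      by (simp only: s_def)
  qed
  have "X i + A i / X i = T * X j ^ 2 * X k ^ 2 - 2 * X j ^ 2 - 2 * X k ^ 2"
    by (simp add: T A field_simps power2_eq_square)
  also have "\<dots> \<in> gen {T, X j, X k}"
    by (intro gen_intros) (auto intro: gen_base)
  finally show "X i + A i / X i \<in> gen {T, X j, X k}" .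
  show "growing (A i) j k 4" "growing (A j) i k 1" "growing (A k) i j 1"
    using growing_power[of j 4 k 4] growing_power[of i 1 k 2] growing_power[of i 1 j 2]
    by (simp_all add: A)
  show "growing (A i) k j 4"
    using growing_power[of k 4 j 4] by (simp add: A add.commute)
  show "T \<in> laurent_ring"
    unfolding T power2_eq_square mult.assoc[symmetric]
    by (intro laurent_intros)
  show "\<exists>v. (\<forall>l. v l \<noteq> 0) \<and> has_value v T t" for t :: complex
  proof (rule torusI)
    fix x :: complex
    assume x: "x \<noteq> 0" "x ^ 2 + (4 - t) * x + 2 = 0"
    have tx: "t * x = x ^ 2 + 4 * x + 2"
      using x(2) by algebra
    define v where "v = (\<lambda>_. 1)(i := x)"
    have v: "v i = x" "v j = 1" "v k = 1"
      using distinct by (auto simp: v_def)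
    have "has_value v T ((v i ^ 2 + v j ^ 4 + v k ^ 4 + 2 * v i * v j ^ 2 + 2 * v i * v k ^ 2)
        / (v i * v j ^ 2 * v k ^ 2))"
      unfolding T using x by (intro has_value_divide has_value_intros) (auto simp: v)
    also have "(v i ^ 2 + v j ^ 4 + v k ^ 4 + 2 * v i * v j ^ 2 + 2 * v i * v k ^ 2)
        / (v i * v j ^ 2 * v k ^ 2) = t * x / x"
      unfolding tx v by (simp add: algebra_simps)
    also have "\<dots> = t"
      using x(1) by simp
    finally show "has_value ((\<lambda>_. 1)(i := x)) T t"
      by (simp only: v_def)
  qed simp
qed (use distinct m in auto)

text \<open>Here the fourth power belongs to \<open>X j\<close>, whose trace enters \<open>T\<close>
  through its square; \<open>i\<close> is one of the two variables with affine trace. The growth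
  exponents are 4 and 1 for \<open>i\<close>, \<open>j\<close>, and 2 and 2 for \<open>i\<close>,
  \<open>k\<close>.\<close>

lemma exchange_B3:
  assumes A: "A i = X j ^ 4 + X k ^ 2" "A j = X i + X k" "A k = X j ^ 4 + X i ^ 2"
    and T: "T = (X j ^ 4 + X i ^ 2 + X k ^ 2 + 2 * X i * X k) / (X j ^ 2 * X i * X k)"
  shows "exchange m A T i j k 4 1 2 2"
proof
  show "has_value (m l) (A l) (A l)" for l
    using index_cases[of l] distinct
    by (auto simp: A intro!: has_value_add has_value_power has_value_m)
  show "A i \<in> gen {X j, X k}"
    unfolding A by (intro gen_intros) (auto intro: gen_base)
  show "T \<in> gen (insert (X l + A l / X l) (X ` (- {l})))" for l
  proof -
    define s where "s = X l + A l / X l"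
    consider "l = i" | "l = j" | "l = k"
      using index_cases by blast
    then have "T \<in> gen (insert s (X ` (- {l})))"
    proof cases
      case 1
      have "T = (s + 2 * X k) / (X j ^ 2 * X k)"
        by (simp add: s_def 1 T A field_simps power2_eq_square)
      then show ?thesis
        using distinct by (simp only: 1) (intro gen_intros gen_X gen_trace; simp)
    next
      case 2
      have "T = (s ^ 2 - 2 * (X i + X k)) / (X i * X k)"
        by (simp add: s_def 2 T A field_simps power2_eq_square power4_eq_xxxx)
      then show ?thesis
        using distinct by (simp only: 2) (intro gen_intros gen_X gen_trace; simp)
    next
      case 3
      have "T = (s + 2 * X i) / (X j ^ 2 * X i)"
        by (simp add: s_def 3 T A field_simps power2_eq_square)
      then show ?thesis
        using distinct by (simp only: 3) (intro gen_intros gen_X gen_trace; simp)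
    qed
    then show ?thesis
      by (simp only: s_def)
  qed
  have "X i + A i / X i = T * X j ^ 2 * X k - 2 * X k"
    by (simp add: T A field_simps power2_eq_square)
  also have "\<dots> \<in> gen {T, X j, X k}"
    by (intro gen_intros) (auto intro: gen_base)
  finally show "X i + A i / X i \<in> gen {T, X j, X k}" .
  show "growing (A i) j k 4" "growing (A j) i k 1" "growing (A i) k j 2" "growing (A k) i j 2"
    using growing_power[of j 4 k 2] growing_power[of i 1 k 1] growing_power[of k 2 j 4]
      growing_power[of i 2 j 4]
    by (simp_all add: A add.commute)
  show "T \<in> laurent_ring"
    unfolding T power2_eq_square mult.assoc[symmetric]
    by (intro laurent_intros)
  show "\<exists>v. (\<forall>l. v l \<noteq> 0) \<and> has_value v T t" for t :: complex
  proof (rule torusI)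
    fix x :: complex
    assume x: "x \<noteq> 0" "x ^ 2 + (2 - t) * x + 2 = 0"
    have tx: "t * x = x ^ 2 + 2 * x + 2"
      using x(2) by algebra
    define v where "v = (\<lambda>_. 1)(i := x)"
    have v: "v i = x" "v j = 1" "v k = 1"
      using distinct by (auto simp: v_def)
    have "has_value v T ((v j ^ 4 + v i ^ 2 + v k ^ 2 + 2 * v i * v k) / (v j ^ 2 * v i * v k))"
      unfolding T using x by (intro has_value_divide has_value_intros) (auto simp: v)
    also have "(v j ^ 4 + v i ^ 2 + v k ^ 2 + 2 * v i * v k) / (v j ^ 2 * v i * v k) = t * x / x"
      unfolding tx v by (simp add: algebra_simps)
    also have "\<dots> = t"
      using x(1) by simp
    finally show "has_value ((\<lambda>_. 1)(i := x)) T t"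
      by (simp only: v_def)
  qed simp
qed (use distinct m in auto)

end

section \<open>Exchange polynomials of permuted matrices\<close>

definition exchange_poly :: "int^3^3 \<Rightarrow> 3 \<Rightarrow> ratfun" where
  "exchange_poly B k =
     (\<Prod>i\<in>UNIV. X i ^ nat (B $ i $ k)) + (\<Prod>i\<in>UNIV. X i ^ nat (- (B $ i $ k)))"

lemma cluster_mutation_eq: "cluster_mutation B k = X(k := exchange_poly B k / X k)"
  by (simp add: cluster_mutation_def exchange_poly_def)

text \<open>Reindexing the product by \<open>\<sigma>\<close> cancels the inverse in
  \<open>permute_matrix\<close>, leaving the entries of \<open>B\<close> itself.\<close>

lemma exchange_poly_permute:
  assumes "\<sigma> permutes UNIV"
  shows "exchange_poly (permute_matrix \<sigma> B) (\<sigma> k) =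
      X (\<sigma> 1) ^ nat (B $ 1 $ k) * (X (\<sigma> 2) ^ nat (B $ 2 $ k) * X (\<sigma> 3) ^ nat (B $ 3 $ k))
      + X (\<sigma> 1) ^ nat (- (B $ 1 $ k))
        * (X (\<sigma> 2) ^ nat (- (B $ 2 $ k)) * X (\<sigma> 3) ^ nat (- (B $ 3 $ k)))"
proof -
  have inv: "inv \<sigma> (\<sigma> a) = a" for a
    using permutes_inverses(2)[OF assms] .
  have prod: "(\<Prod>i\<in>UNIV. f i) = f (\<sigma> 1) * (f (\<sigma> 2) * f (\<sigma> 3))" for f :: "3 \<Rightarrow> ratfun"
  proof -
    have "(\<Prod>i\<in>UNIV. f i) = (\<Prod>i\<in>UNIV. f (\<sigma> i))"
      by (rule prod.permute[OF assms, unfolded comp_def])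
    also have "\<dots> = f (\<sigma> 1) * (f (\<sigma> 2) * f (\<sigma> 3))"
      by (simp only: UNIV_3 prod.insert prod.empty finite.intros) simp
    finally show ?thesis .
  qed
  show ?thesis
    by (simp add: exchange_poly_def prod permute_matrix_def inv)
qed

theorem theorem1p5:
  fixes k1 k2 k3 :: nat
  shows "invariant_field (gen_mutation k1 k2 k3) = adjoin_field (T_hat k1 k2 k3) \<and>
    invariant_field (gen_mutation k1 k2 k3) \<inter> laurent_ring = adjoin_ring (T_hat k1 k2 k3) \<and>
    (\<forall>\<sigma> :: 3 \<Rightarrow> 3. \<sigma> permutes UNIV \<longrightarrow>
      invariant_field (cluster_mutation (permute_matrix \<sigma> B1)) \<inter> laurent_ring = adjoin_ring (T1 (X \<circ> \<sigma>)) \<and>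
      invariant_field (cluster_mutation (permute_matrix \<sigma> B2)) \<inter> laurent_ring = adjoin_ring (T2 (X \<circ> \<sigma>)) \<and>
      invariant_field (cluster_mutation (permute_matrix \<sigma> B3)) \<inter> laurent_ring = adjoin_ring (T3 (X \<circ> \<sigma>)))"
proof (intro conjI allI impI)
  define A where "A l = (if l = 1 then X 2 ^ 2 + of_nat k1 * X 2 * X 3 + X 3 ^ 2
      else if l = 2 then X 1 ^ 2 + of_nat k2 * X 1 * X 3 + X 3 ^ 2
      else X 1 ^ 2 + of_nat k3 * X 1 * X 2 + X 2 ^ 2)" for l :: 3
  have "gen_mutation k1 k2 k3 l = X(l := A l / X l)" for l
    using exhaust_3[of l] by (auto simp: gen_mutation_def A_def)
  then interpret exchange "gen_mutation k1 k2 k3" A "T_hat k1 k2 k3" 1 2 3 2 2 2 2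
    by (intro exchange_hat[of 1 2 3 _ _ k1 k2 k3]) (simp_all add: A_def T_hat_def)
  show "invariant_field (gen_mutation k1 k2 k3) = adjoin_field (T_hat k1 k2 k3)"
    by (rule invariant_field_eq)
  show "invariant_field (gen_mutation k1 k2 k3) \<inter> laurent_ring = adjoin_ring (T_hat k1 k2 k3)"
    by (rule laurent_invariants_eq)
next
  fix \<sigma> :: "3 \<Rightarrow> 3"
  assume \<sigma>: "\<sigma> permutes UNIV"
  have distinct: "\<sigma> 1 \<noteq> \<sigma> 2" "\<sigma> 1 \<noteq> \<sigma> 3" "\<sigma> 2 \<noteq> \<sigma> 3"
    using permutes_inj[OF \<sigma>] by (simp_all add: inj_eq)
  note poly = exchange_poly_permute[OF \<sigma>]
  let ?A = "\<lambda>B. exchange_poly (permute_matrix \<sigma> B)"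
  \<comment> \<open>The generalized relation with all three parameters equal to 0.\<close>
  have "exchange (cluster_mutation (permute_matrix \<sigma> B1)) (?A B1) (T1 (X \<circ> \<sigma>)) (\<sigma> 1) (\<sigma> 2) (\<sigma> 3) 2 2 2 2"
  proof (rule exchange_hat[OF distinct cluster_mutation_eq, of _ 0 0 0])
    show "?A B1 (\<sigma> 1) = X (\<sigma> 2) ^ 2 + of_nat 0 * X (\<sigma> 2) * X (\<sigma> 3) + X (\<sigma> 3) ^ 2"
      "?A B1 (\<sigma> 2) = X (\<sigma> 1) ^ 2 + of_nat 0 * X (\<sigma> 1) * X (\<sigma> 3) + X (\<sigma> 3) ^ 2"
      "?A B1 (\<sigma> 3) = X (\<sigma> 1) ^ 2 + of_nat 0 * X (\<sigma> 1) * X (\<sigma> 2) + X (\<sigma> 2) ^ 2"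
      by (simp_all add: poly B1_def)
  qed (simp add: T1_def)
  then show "invariant_field (cluster_mutation (permute_matrix \<sigma> B1)) \<inter> laurent_ring
      = adjoin_ring (T1 (X \<circ> \<sigma>))"
    by (rule exchange.laurent_invariants_eq)
  have "exchange (cluster_mutation (permute_matrix \<sigma> B2)) (?A B2) (T2 (X \<circ> \<sigma>)) (\<sigma> 1) (\<sigma> 2) (\<sigma> 3) 4 1 4 1"
  proof (rule exchange_B2[OF distinct cluster_mutation_eq])
    show "?A B2 (\<sigma> 1) = X (\<sigma> 2) ^ 4 + X (\<sigma> 3) ^ 4" "?A B2 (\<sigma> 2) = X (\<sigma> 1) + X (\<sigma> 3) ^ 2"
      "?A B2 (\<sigma> 3) = X (\<sigma> 1) + X (\<sigma> 2) ^ 2"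
      by (simp_all add: poly B2_def)
  qed (simp add: T2_def)
  then show "invariant_field (cluster_mutation (permute_matrix \<sigma> B2)) \<inter> laurent_ring
      = adjoin_ring (T2 (X \<circ> \<sigma>))"
    by (rule exchange.laurent_invariants_eq)
  \<comment> \<open>The first two indices are exchanged, because the distinguished variable must not
    be the one occurring to the fourth power.\<close>
  have "exchange (cluster_mutation (permute_matrix \<sigma> B3)) (?A B3) (T3 (X \<circ> \<sigma>)) (\<sigma> 2) (\<sigma> 1) (\<sigma> 3) 4 1 2 2"
  proof (rule exchange_B3[OF distinct(1)[symmetric] distinct(3,2) cluster_mutation_eq])
    show "?A B3 (\<sigma> 2) = X (\<sigma> 1) ^ 4 + X (\<sigma> 3) ^ 2" "?A B3 (\<sigma> 1) = X (\<sigma> 2) + X (\<sigma> 3)"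
      "?A B3 (\<sigma> 3) = X (\<sigma> 1) ^ 4 + X (\<sigma> 2) ^ 2"
      by (simp_all add: poly B3_def)
  qed (simp add: T3_def)
  then show "invariant_field (cluster_mutation (permute_matrix \<sigma> B3)) \<inter> laurent_ring
      = adjoin_ring (T3 (X \<circ> \<sigma>))"
    by (rule exchange.laurent_invariants_eq)
qed

end
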